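(* Let $G$ be a finite group, $S$ a supercharacter theory of $G$, and $N$ an $S$-normal subgroup of $G$. Then the following conditions (1), (3), (4), (5) are equivalent, and when $[G,S]\leq N$ they are also equivalent to (2): (1) $(G,N)$ is an $S$-GCP. (2) $S$ is a $\Delta$-product over $[G,S]$ and $N$. (3) $|\mathrm{Cl}_S(g)|=|[G,S]|$ for all $g\in G\setminus N$. (4) For any $g\in G\setminus N$ and $z\in [G,S]$, there exists $y\in \mathrm{Cl}_S(g)$ such that $g^{-1}y=z$. (5) Every character in $\mathrm{Irr}(S\mid[G,S])$ vanishes on $G\setminus N$.
   Context: $\mathrm{Irr}(G)$ is the set of complex irreducible characters of the finite group $G$. A supercharacter theory $S$ of $G$ is a pair $(\mathcal X,\mathcal Y)$, where $\mathcal X$ is a partition of $\mathrm{Irr}(G)$ and $\mathcal Y$ is a partition of $G$, such that $\{1\}\in\mathcal Y$, $|\mathcal X|=|\mathcal Y|$, and for each $X\in\mathcal X$ the character $\sigma_X=\sum_{\chi\in X}\chi(1)\chi$ is constant on each $Y\in\mathcal Y$. The parts $Y\in\mathcal Y$ are the $S$-classes, $\mathrm{Cl}_S(g)$ is the $S$-class containing $g$, the characters $\sigma_X$ are the $S$-characters, and $\mathrm{Irr}(S)=\{\sigma_X: X\in\mathcal X\}$. For a character $\chi$, $\ker(\chi)=\{g\in G:\chi(g)=\chi(1)\}$. A subgroup $N\le G$ is $S$-normal if it is a union of $S$-classes. For $H\le G$, $[H,S]=\langle g^{-1}k: g\in H,\ k\in \mathrm{Cl}_S(g)\rangle$; the subgroup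 $[G,S]$ is $S$-normal. For an $S$-normal subgroup $N$, $\mathrm{Irr}(S\mid N)$ is the set of $\chi\in\mathrm{Irr}(S)$ with $N\not\le\ker(\chi)$. An element $g\in G$ is an $S$-Camina element if $\chi(g)=0$ for all $\chi\in\mathrm{Irr}(S\mid[G,S])$. For an $S$-normal subgroup $N$, the pair $(G,N)$ is a generalised $S$-Camina pair ($S$-GCP) if every element of $G\setminus N$ is an $S$-Camina element. For $S$-normal subgroups $M\le N$ of $G$, $S$ is a $\Delta$-product over $M$ and $N$ if every $S$-class lying outside of $N$ is a union of full $M$-cosets. *)

theory Defs
  imports
    "Jordan_Normal_Form.VS_Connect"
    "HOL-Algebra.Generated_Groups"
    "HOL-Library.Disjoint_Sets"
begin

section \<open>Complex irreducible characters\<close>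

definition mat_trace :: "complex mat \<Rightarrow> complex" where
  "mat_trace A = (\<Sum>i<dim_row A. A $$ (i, i))"

text \<open>The group of units of the matrix ring is $GL_n(\mathbf{C})$.\<close>

definition matrix_rep :: "('a, 'b) monoid_scheme \<Rightarrow> nat \<Rightarrow> ('a \<Rightarrow> complex mat) \<Rightarrow> bool" where
  "matrix_rep G n \<rho> \<longleftrightarrow> \<rho> \<in> hom G (units_of (ring_mat TYPE(complex) n ()))"

definition irreducible_rep :: "('a, 'b) monoid_scheme \<Rightarrow> nat \<Rightarrow> ('a \<Rightarrow> complex mat) \<Rightarrow> bool" where
  "irreducible_rep G n \<rho> \<longleftrightarrow> matrix_rep G n \<rho> \<and> n > 0 \<and>
     (\<forall>W. VectorSpace.subspace class_ring W (module_vec TYPE(complex) n) \<and>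
          (\<forall>g\<in>carrier G. \<forall>w\<in>W. \<rho> g *\<^sub>v w \<in> W)
        \<longrightarrow> W = {0\<^sub>v n} \<or> W = carrier_vec n)"

text \<open>Functions on the group are restricted to the carrier, so that two of them are equal exactly
  when they agree on the group.\<close>

definition rep_character :: "('a, 'b) monoid_scheme \<Rightarrow> ('a \<Rightarrow> complex mat) \<Rightarrow> 'a \<Rightarrow> complex" where
  "rep_character G \<rho> = (\<lambda>g\<in>carrier G. mat_trace (\<rho> g))"

definition Irr :: "('a, 'b) monoid_scheme \<Rightarrow> ('a \<Rightarrow> complex) set" where
  "Irr G = {rep_character G \<rho> |\<rho> n. irreducible_rep G n \<rho>}"

definition char_ker :: "('a, 'b) monoid_scheme \<Rightarrow> ('a \<Rightarrow> complex) \<Rightarrow> 'a set" where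
  "char_ker G \<chi> = {g \<in> carrier G. \<chi> g = \<chi> \<one>\<^bsub>G\<^esub>}"

section \<open>Supercharacter theories\<close>

definition super_sigma :: "('a, 'b) monoid_scheme \<Rightarrow> ('a \<Rightarrow> complex) set \<Rightarrow> 'a \<Rightarrow> complex" where
  "super_sigma G X = (\<lambda>g\<in>carrier G. \<Sum>\<chi>\<in>X. \<chi> \<one>\<^bsub>G\<^esub> * \<chi> g)"

type_synonym 'a super_theory = "('a \<Rightarrow> complex) set set \<times> 'a set set"

definition supercharacter_theory :: "('a, 'b) monoid_scheme \<Rightarrow> 'a super_theory \<Rightarrow> bool" where
  "supercharacter_theory G S \<longleftrightarrow> (case S of (\<X>, \<Y>) \<Rightarrow>
     partition_on (Irr G) \<X> \<and>
     partition_on (carrier G) \<Y> \<and>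
     {\<one>\<^bsub>G\<^esub>} \<in> \<Y> \<and>
     card \<X> = card \<Y> \<and>
     (\<forall>X\<in>\<X>. \<forall>Y\<in>\<Y>. \<forall>g\<in>Y. \<forall>h\<in>Y. super_sigma G X g = super_sigma G X h))"

definition super_classes :: "'a super_theory \<Rightarrow> 'a set set" where
  "super_classes S = snd S"

definition super_cl :: "'a super_theory \<Rightarrow> 'a \<Rightarrow> 'a set" where
  "super_cl S g = (THE Y. Y \<in> super_classes S \<and> g \<in> Y)"

definition super_Irr :: "('a, 'b) monoid_scheme \<Rightarrow> 'a super_theory \<Rightarrow> ('a \<Rightarrow> complex) set" where
  "super_Irr G S = super_sigma G ` fst S"

definition super_normal :: "('a, 'b) monoid_scheme \<Rightarrow> 'a super_theory \<Rightarrow> 'a set \<Rightarrow> bool" where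
  "super_normal G S N \<longleftrightarrow> subgroup N G \<and> (\<exists>\<C>\<subseteq>super_classes S. N = \<Union>\<C>)"

text \<open>The commutator $[H,S]$.\<close>

definition super_comm :: "('a, 'b) monoid_scheme \<Rightarrow> 'a set \<Rightarrow> 'a super_theory \<Rightarrow> 'a set" where
  "super_comm G H S = generate G {inv\<^bsub>G\<^esub> g \<otimes>\<^bsub>G\<^esub> k |g k. g \<in> H \<and> k \<in> super_cl S g}"

text \<open>The set $\mathrm{Irr}(S\mid N)$.\<close>

definition super_Irr_over ::
  "('a, 'b) monoid_scheme \<Rightarrow> 'a super_theory \<Rightarrow> 'a set \<Rightarrow> ('a \<Rightarrow> complex) set" where
  "super_Irr_over G S N = {\<chi> \<in> super_Irr G S. \<not> N \<subseteq> char_ker G \<chi>}"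

definition super_Camina_element :: "('a, 'b) monoid_scheme \<Rightarrow> 'a super_theory \<Rightarrow> 'a \<Rightarrow> bool" where
  "super_Camina_element G S g \<longleftrightarrow>
     g \<in> carrier G \<and> (\<forall>\<chi>\<in>super_Irr_over G S (super_comm G (carrier G) S). \<chi> g = 0)"

definition super_GCP :: "('a, 'b) monoid_scheme \<Rightarrow> 'a super_theory \<Rightarrow> 'a set \<Rightarrow> bool" where
  "super_GCP G S N \<longleftrightarrow>
     super_normal G S N \<and> (\<forall>g\<in>carrier G - N. super_Camina_element G S g)"

text \<open>An \<open>S\<close>-class meets the \<open>S\<close>-normal subgroup \<open>N\<close> only if it is contained in it, so lying outside
  \<open>N\<close> is being disjoint from it. Left and right cosets of the \<open>S\<close>-normal subgroup \<open>M\<close> coincide.\<close>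

definition super_Delta_product ::
  "('a, 'b) monoid_scheme \<Rightarrow> 'a super_theory \<Rightarrow> 'a set \<Rightarrow> 'a set \<Rightarrow> bool" where
  "super_Delta_product G S M N \<longleftrightarrow>
     super_normal G S M \<and> super_normal G S N \<and> M \<subseteq> N \<and>
     (\<forall>Y\<in>super_classes S. Y \<inter> N = {} \<longrightarrow> (\<exists>\<C>\<subseteq>rcosets\<^bsub>G\<^esub> M. Y = \<Union>\<C>))"

end

theory Submission
  imports Defs
    "HOL-Library.Function_Algebras"
    "HOL-Algebra.Multiplicative_Group"
    "Jordan_Normal_Form.Spectral_Radius"
begin

text \<open>Write $K = [G,S]$. Since $K$ contains every $g^{-1}k$ with $k \in \mathrm{Cl}_S(g)$, each
  \<open>S\<close>-class satisfies $\mathrm{Cl}_S(g) \subseteq gK$. Each of the five conditions (for the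
  \<open>\<Delta>\<close>-product: if $K \le N$) says that this inclusion is an equality for all $g$ outside $N$.
  For the conditions on the size of the class, on the products $g^{-1}y$ and on cosets this is
  elementary (\<open>card_class_iff_coset\<close>, \<open>translates_iff_coset\<close>, \<open>union_of_cosets_iff_coset\<close>), up to
  the fact that $K$ is \<open>S\<close>-normal, and hence normal.

  The bridge to characters (\<open>vanishing_iff_coset\<close>) is the following sum over a coset of an
  \<open>S\<close>-normal subgroup $M$ (\<open>\<sigma>_coset_sum\<close>): $\sum_{m \in M} \sigma_X(gm)$ equals
  $|M|\,\sigma_X(g)$ if $M \le \ker \sigma_X$, and $0$ otherwise. If $\mathrm{Cl}_S(g) = gK$, then
  $\sigma_X$ is constant on $gK$, so $|K|\,\sigma_X(g) = 0$ as soon as $K \not\le \ker\sigma_X$.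
  Conversely, write the indicator function of $\mathrm{Cl}_S(g)$ as $\sum_X c_X \sigma_X$ and sum it
  over $gK$. The left side gives $|\mathrm{Cl}_S(g)|$. If the $\sigma_X$ with $K \not\le \ker\sigma_X$
  vanish at $g$, then every $\sigma_X$ sums to $|K|\,\sigma_X(g)$, so the right side is $|K|$ times the
  value of the indicator at $g$, which is $|K|$.

  All of this rests on one structural fact: the functions constant on the \<open>S\<close>-classes are exactly the
  linear combinations of the $\sigma_X$ (\<open>superclass_function_expansion\<close>). The convolution relations
  $\sigma_X * \sigma_{X'} = \delta_{X,X'} |G| \sigma_X$, which come from Schur's lemma, make the $\sigma_X$
  linearly independent, and $|\mathcal X| = |\mathcal Y|$ makes them a basis. So these functions are
  closed under convolution, under $g \mapsto g^{-1}$ (because $\chi(g^{-1}) = \overline{\chi(g)}$), and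
  invariant under conjugation. Hence \<open>S\<close>-classes behave like conjugacy classes: they are closed under
  conjugation, their inverses are \<open>S\<close>-classes, and a product of two of them is a union of
  \<open>S\<close>-classes. This is what makes $K$ an \<open>S\<close>-normal subgroup.\<close>

section \<open>Traces and matrices of finite order\<close>

lemma mat_trace_comm:
  assumes A: "A \<in> carrier_mat n m" and B: "B \<in> carrier_mat m n"
  shows "mat_trace (A * B) = mat_trace (B * A)"
proof -
  have "mat_trace (A * B) = (\<Sum>i<n. \<Sum>j<m. A $$ (i, j) * B $$ (j, i))"
    using A B by (auto simp: mat_trace_def scalar_prod_def lessThan_atLeast0 intro!: sum.cong)
  also have "\<dots> = (\<Sum>j<m. \<Sum>i<n. B $$ (j, i) * A $$ (i, j))"
    by (subst sum.swap) (simp add: mult.commute)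
  also have "\<dots> = mat_trace (B * A)"
    using A B by (auto simp: mat_trace_def scalar_prod_def lessThan_atLeast0 intro!: sum.cong)
  finally show ?thesis .
qed

lemma mat_mult_entry:
  assumes "A \<in> carrier_mat n m" "B \<in> carrier_mat m p" "i < n" "j < p"
  shows "(A * B) $$ (i, j) = (\<Sum>k<m. A $$ (i, k) * B $$ (k, j))"
  using assms by (auto simp: scalar_prod_def lessThan_atLeast0 intro!: sum.cong)

lemma upper_triangular_mult:
  fixes A B :: "'x :: semiring_0 mat"
  assumes A: "A \<in> carrier_mat n n" "upper_triangular A"
    and B: "B \<in> carrier_mat n n" "upper_triangular B"
  shows "upper_triangular (A * B)" and "\<And>i. i < n \<Longrightarrow> (A * B) $$ (i, i) = A $$ (i, i) * B $$ (i, i)"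
proof -
  have zero: "A $$ (i, k) * B $$ (k, j) = 0" if "i < n" "k < n" "j \<le> i" "\<not> (k = i \<and> k = j)" for i j k
  proof (cases "k < i")
    case True
    then show ?thesis using that A upper_triangularD[of A k i] by auto
  next
    case False
    then show ?thesis using that B upper_triangularD[of B j k] by auto
  qed
  have entry: "(A * B) $$ (i, j) = (\<Sum>k\<in>{0..<n}. A $$ (i, k) * B $$ (k, j))" if "i < n" "j < n" for i j
    using A B that by (simp add: scalar_prod_def)
  show "upper_triangular (A * B)"
  proof (rule upper_triangularI)
    fix i j assume "j < i" "i < dim_row (A * B)"
    then show "(A * B) $$ (i, j) = 0"
      using A by (subst entry) (auto intro!: sum.neutral zero)
  qed
  show "(A * B) $$ (i, i) = A $$ (i, i) * B $$ (i, i)" if "i < n" for i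
  proof -
    have "(\<Sum>k\<in>{0..<n}. A $$ (i, k) * B $$ (k, i)) = (\<Sum>k\<in>{i}. A $$ (i, k) * B $$ (k, i))"
      using that by (intro sum.mono_neutral_right) (auto intro: zero)
    then show ?thesis using that by (simp add: entry)
  qed
qed

lemma upper_triangular_pow:
  fixes A :: "'x :: semiring_1 mat"
  assumes A: "A \<in> carrier_mat n n" "upper_triangular A"
  shows "upper_triangular (A ^\<^sub>m k)" and "\<And>i. i < n \<Longrightarrow> (A ^\<^sub>m k) $$ (i, i) = (A $$ (i, i)) ^ k"
proof (induction k)
  case 0
  show "upper_triangular (A ^\<^sub>m 0)" "\<And>i. i < n \<Longrightarrow> (A ^\<^sub>m 0) $$ (i, i) = (A $$ (i, i)) ^ 0"
    using A by auto
next
  case (Suc k)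
  have Ak: "A ^\<^sub>m k \<in> carrier_mat n n" using A by simp
  show "upper_triangular (A ^\<^sub>m Suc k)"
    using upper_triangular_mult[OF Ak Suc.IH(1) A] by simp
  show "(A ^\<^sub>m Suc k) $$ (i, i) = (A $$ (i, i)) ^ Suc k" if "i < n" for i
    using upper_triangular_mult[OF Ak Suc.IH(1) A] Suc.IH(2) that by (simp add: power_commutes)
qed

lemma root_of_unity_cnj:
  fixes z :: complex
  assumes "z ^ N = 1" "N > 0"
  shows "z ^ (N - 1) = cnj z"
proof -
  have "norm z ^ N = 1" using arg_cong[OF assms(1), of norm] by (simp add: norm_power)
  then have z: "norm z = 1" using assms(2) power_eq_imp_eq_base[of "norm z" N 1] by simp
  then have "cnj z * z = 1" by (simp add: complex_norm_square[symmetric] mult.commute)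
  moreover have "z ^ (N - 1) * z = 1" using assms by (simp flip: power_Suc2)
  moreover have "z \<noteq> 0" using z by auto
  ultimately show ?thesis by (metis mult_cancel_right)
qed

text \<open>Over the complex numbers, a matrix \<open>A\<close> of finite order is similar to an upper triangular one whose
  diagonal entries are roots of unity. Powers act on the diagonal entrywise, and inverting a root of
  unity means conjugating it. Here \<open>A ^\<^sub>m (N - 1)\<close> is the inverse of \<open>A\<close>.\<close>

lemma trace_finite_order:
  assumes A: "A \<in> carrier_mat n n" and N: "A ^\<^sub>m N = 1\<^sub>m n" "N > 0"
  shows "mat_trace (A ^\<^sub>m (N - 1)) = cnj (mat_trace A)"
proof -
  obtain es where "char_poly A = (\<Prod>a\<leftarrow>es. [:- a, 1:])"
    using char_poly_factorized[OF A] by auto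
  then obtain B where B: "B \<in> carrier_mat n n" "upper_triangular B" "similar_mat A B"
    using schur_decomposition_exists[OF A] by auto
  obtain P Q where wit: "similar_mat_wit A B P Q" using B by (auto simp: similar_mat_def)
  have PQ: "P \<in> carrier_mat n n" "Q \<in> carrier_mat n n" "Q * P = 1\<^sub>m n"
    using similar_mat_witD2[OF A wit] by auto
  have tr: "mat_trace (A ^\<^sub>m k) = (\<Sum>i<n. (B $$ (i, i)) ^ k)" for k
  proof -
    have Bk: "B ^\<^sub>m k \<in> carrier_mat n n" using B by simp
    have "mat_trace (A ^\<^sub>m k) = mat_trace (P * (B ^\<^sub>m k * Q))"
      using similar_mat_wit_pow_id[OF wit, of k] PQ Bk by (simp add: assoc_mult_mat[of _ n n _ n _ n])
    also have "\<dots> = mat_trace ((B ^\<^sub>m k * Q) * P)"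
      using PQ Bk by (intro mat_trace_comm) auto
    also have "(B ^\<^sub>m k * Q) * P = B ^\<^sub>m k"
      using PQ right_mult_one_mat[OF Bk] by (simp add: assoc_mult_mat[OF Bk])
    finally show ?thesis
      using upper_triangular_pow[OF B(1,2)] B(1) by (simp add: mat_trace_def)
  qed
  have "B ^\<^sub>m N = 1\<^sub>m n"
    using similar_mat_wit_pow_id[OF similar_mat_wit_sym[OF wit], of N] N PQ by simp
  then have root: "(B $$ (i, i)) ^ N = 1" if "i < n" for i
    using upper_triangular_pow(2)[OF B(1,2) that, of N] that by simp
  have "mat_trace (A ^\<^sub>m (N - 1)) = (\<Sum>i<n. cnj (B $$ (i, i)))"
    unfolding tr by (intro sum.cong refl root_of_unity_cnj[OF root N(2)]) simp
  also have "\<dots> = cnj (mat_trace (A ^\<^sub>m 1))" unfolding tr by simp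
  finally show ?thesis using A by simp
qed

section \<open>Representations and Schur's lemma\<close>

lemma subspace_module_vecI:
  fixes W :: "complex vec set"
  assumes "W \<subseteq> carrier_vec n" "0\<^sub>v n \<in> W"
    "\<And>v w. v \<in> W \<Longrightarrow> w \<in> W \<Longrightarrow> v + w \<in> W" "\<And>c v. v \<in> W \<Longrightarrow> c \<cdot>\<^sub>v v \<in> W"
  shows "VectorSpace.subspace class_ring W (module_vec TYPE(complex) n)"
proof -
  have vs: "vectorspace class_ring (module_vec TYPE(complex) n)"
    by (rule vec_vs)
  then interpret V: vectorspace class_ring "module_vec TYPE(complex) n" .
  show ?thesis
    using assms V.module_axioms
    by (intro VectorSpace.subspace.intro[OF vs] LinearCombinations.submodule.intro)
      (auto simp: module_vec_simps)
qed

lemma matrix_repD: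
  assumes G: "group G" and rep: "matrix_rep G n \<rho>"
  shows "\<And>g. g \<in> carrier G \<Longrightarrow> \<rho> g \<in> carrier_mat n n"
    and "\<And>g h. g \<in> carrier G \<Longrightarrow> h \<in> carrier G \<Longrightarrow> \<rho> (g \<otimes>\<^bsub>G\<^esub> h) = \<rho> g * \<rho> h"
    and "\<rho> \<one>\<^bsub>G\<^esub> = 1\<^sub>m n"
proof -
  let ?R = "ring_mat TYPE(complex) n ()"
  have hom: "\<rho> \<in> hom G (units_of ?R)"
    using rep by (simp add: matrix_rep_def)
  show 1: "\<rho> g \<in> carrier_mat n n" if "g \<in> carrier G" for g
    using hom_in_carrier[OF hom that]
    by (auto simp: units_of_carrier Units_def ring_mat_simps)
  show "\<rho> (g \<otimes>\<^bsub>G\<^esub> h) = \<rho> g * \<rho> h" if "g \<in> carrier G" "h \<in> carrier G" for g h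
    using hom_mult[OF hom that] by (simp add: units_of_mult ring_mat_simps)
  interpret R: ring ?R by (rule ring_mat)
  have "group (units_of ?R)" by (rule R.units_group)
  then have "group_hom G (units_of ?R) \<rho>"
    using G hom by (simp add: group_hom_def group_hom_axioms_def)
  then have "\<rho> \<one>\<^bsub>G\<^esub> = \<one>\<^bsub>units_of ?R\<^esub>"
    by (rule group_hom.hom_one)
  then show "\<rho> \<one>\<^bsub>G\<^esub> = 1\<^sub>m n"
    by (simp add: units_of_one ring_mat_simps)
qed

lemma zero_mat_if_kills_unit_vecs:
  fixes T :: "complex mat"
  assumes T: "T \<in> carrier_mat n m" and kills: "\<And>j. j < m \<Longrightarrow> T *\<^sub>v unit_vec m j = 0\<^sub>v n"
  shows "T = 0\<^sub>m n m"
proof (rule mat_col_eqI)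
  fix j assume j: "j < dim_col (0\<^sub>m n m :: complex mat)"
  then have "T *\<^sub>v unit_vec m j = col T j"
    using T by (intro eq_vecI) auto
  then show "col T j = col (0\<^sub>m n m) j"
    using kills[of j] j by simp
qed (use T in auto)

text \<open>The kernel of an intertwiner is an invariant subspace, so it is everything once it contains a
  nonzero vector.\<close>

lemma intertwiner_kernel:
  assumes G: "group G" and \<rho>: "matrix_rep G n \<rho>" and \<sigma>: "irreducible_rep G m \<sigma>"
    and T: "T \<in> carrier_mat n m"
    and int: "\<And>g. g \<in> carrier G \<Longrightarrow> \<rho> g * T = T * \<sigma> g"
    and v: "v \<in> carrier_vec m" "v \<noteq> 0\<^sub>v m" "T *\<^sub>v v = 0\<^sub>v n"
  shows "T = 0\<^sub>m n m"
proof -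
  have \<sigma>': "matrix_rep G m \<sigma>" using \<sigma> by (simp add: irreducible_rep_def)
  note r = matrix_repD[OF G \<rho>] and s = matrix_repD[OF G \<sigma>']
  let ?W = "{w \<in> carrier_vec m. T *\<^sub>v w = 0\<^sub>v n}"
  have sub: "VectorSpace.subspace class_ring ?W (module_vec TYPE(complex) m)"
    by (rule subspace_module_vecI)
      (use T in \<open>auto simp: mult_add_distrib_mat_vec mult_mat_vec\<close>)
  have "\<sigma> g *\<^sub>v w \<in> ?W" if g: "g \<in> carrier G" and w: "w \<in> ?W" for g w
  proof -
    have "T *\<^sub>v (\<sigma> g *\<^sub>v w) = (T * \<sigma> g) *\<^sub>v w"
      using T s(1)[OF g] w by (simp add: assoc_mult_mat_vec)
    also have "\<dots> = \<rho> g *\<^sub>v (T *\<^sub>v w)"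
      unfolding int[OF g, symmetric] using T r(1)[OF g] w by (simp add: assoc_mult_mat_vec)
    also have "\<dots> = 0\<^sub>v n" using w r(1)[OF g] by auto
    finally show ?thesis using s(1)[OF g] w by auto
  qed
  then have "?W = {0\<^sub>v m} \<or> ?W = carrier_vec m"
    using \<sigma> sub unfolding irreducible_rep_def by blast
  moreover have "v \<in> ?W" using v by simp
  ultimately have W: "?W = carrier_vec m" using v by blast
  show ?thesis
  proof (rule zero_mat_if_kills_unit_vecs[OF T])
    fix j
    have "unit_vec m j \<in> ?W" unfolding W by simp
    then show "T *\<^sub>v unit_vec m j = 0\<^sub>v n" by simp
  qed
qed

text \<open>The image of an intertwiner is an invariant subspace too, so a nonzero intertwiner into an
  irreducible representation is onto.\<close>

lemma intertwiner_image:
  assumes G: "group G" and \<rho>: "irreducible_rep G n \<rho>" and \<sigma>: "matrix_rep G m \<sigma>"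
    and T: "T \<in> carrier_mat n m" "T \<noteq> 0\<^sub>m n m"
    and int: "\<And>g. g \<in> carrier G \<Longrightarrow> \<rho> g * T = T * \<sigma> g"
    and v: "v \<in> carrier_vec n"
  shows "\<exists>w\<in>carrier_vec m. T *\<^sub>v w = v"
proof -
  have \<rho>': "matrix_rep G n \<rho>" using \<rho> by (simp add: irreducible_rep_def)
  note r = matrix_repD[OF G \<rho>'] and s = matrix_repD[OF G \<sigma>]
  let ?W = "(\<lambda>w. T *\<^sub>v w) ` carrier_vec m"
  have sub: "VectorSpace.subspace class_ring ?W (module_vec TYPE(complex) n)"
  proof (rule subspace_module_vecI)
    show "?W \<subseteq> carrier_vec n" using T by auto
    show "0\<^sub>v n \<in> ?W" using T by (intro image_eqI[of _ _ "0\<^sub>v m"]) auto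
    show "v + w \<in> ?W" if "v \<in> ?W" "w \<in> ?W" for v w
      using that T(1) by (auto simp: mult_add_distrib_mat_vec[symmetric])
    show "c \<cdot>\<^sub>v v \<in> ?W" if "v \<in> ?W" for c v
      using that T(1) by (auto simp: mult_mat_vec[symmetric])
  qed
  have "\<rho> g *\<^sub>v w \<in> ?W" if g: "g \<in> carrier G" and w: "w \<in> ?W" for g w
  proof -
    obtain u where u: "u \<in> carrier_vec m" "w = T *\<^sub>v u" using w by auto
    have "\<rho> g *\<^sub>v w = (\<rho> g * T) *\<^sub>v u"
      using T r(1)[OF g] u by (simp add: assoc_mult_mat_vec)
    also have "\<dots> = T *\<^sub>v (\<sigma> g *\<^sub>v u)"
      unfolding int[OF g] using T s(1)[OF g] u by (simp add: assoc_mult_mat_vec)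
    finally show ?thesis using s(1)[OF g] u by auto
  qed
  then have "?W = {0\<^sub>v n} \<or> ?W = carrier_vec n"
    using \<rho> sub unfolding irreducible_rep_def by blast
  moreover have "?W \<noteq> {0\<^sub>v n}"
  proof
    assume W: "?W = {0\<^sub>v n}"
    have "T = 0\<^sub>m n m"
    proof (rule zero_mat_if_kills_unit_vecs[OF T(1)])
      fix j
      have "T *\<^sub>v unit_vec m j \<in> ?W" by simp
      then show "T *\<^sub>v unit_vec m j = 0\<^sub>v n" unfolding W by simp
    qed
    then show False using T by simp
  qed
  ultimately have "?W = carrier_vec n" by simp
  then have "v \<in> ?W" using v by simp
  then show ?thesis by auto
qed

text \<open>The first half of Schur's lemma, for representations whose degrees may differ a priori. A nonzero
  intertwiner has a two-sided inverse, and conjugating by it preserves the trace.\<close>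

lemma nonzero_intertwiner_imp_same_character:
  assumes G: "group G" and \<rho>: "irreducible_rep G n \<rho>" and \<sigma>: "irreducible_rep G m \<sigma>"
    and T: "T \<in> carrier_mat n m" "T \<noteq> 0\<^sub>m n m"
    and int: "\<And>g. g \<in> carrier G \<Longrightarrow> \<rho> g * T = T * \<sigma> g"
  shows "rep_character G \<rho> = rep_character G \<sigma>"
proof -
  have \<rho>': "matrix_rep G n \<rho>" and \<sigma>': "matrix_rep G m \<sigma>"
    using \<rho> \<sigma> by (auto simp: irreducible_rep_def)
  note r = matrix_repD[OF G \<rho>'] and s = matrix_repD[OF G \<sigma>']
  \<comment> \<open>Preimages of the unit vectors are the columns of a right inverse \<open>B\<close> of \<open>T\<close>; it is also a left
    inverse, because \<open>T\<close> is injective.\<close>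
  have "\<forall>j. \<exists>w. w \<in> carrier_vec m \<and> T *\<^sub>v w = unit_vec n j"
    using intertwiner_image[OF G \<rho> \<sigma>' T int] by (meson unit_vec_carrier)
  then obtain f where f: "\<And>j. f j \<in> carrier_vec m" "\<And>j. T *\<^sub>v f j = unit_vec n j"
    by metis
  define B where "B = mat_of_cols m (map f [0..<n])"
  have B: "B \<in> carrier_mat m n" by (auto simp: B_def)
  have colB: "col B j = f j" if "j < n" for j
    using that f by (simp add: B_def)
  have TB: "T * B = 1\<^sub>m n"
  proof (rule mat_col_eqI)
    fix j assume "j < dim_col (1\<^sub>m n :: complex mat)"
    then have j: "j < n" by simp
    show "col (T * B) j = col (1\<^sub>m n) j"
      using j col_mult2[OF T(1) B j] by (simp add: colB f)
  qed (use T B in auto)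
  have BT: "B * T = 1\<^sub>m m"
  proof -
    define D where "D = B * T - 1\<^sub>m m"
    have D: "D \<in> carrier_mat m m" using B T by (auto simp: D_def)
    have "T * D = T * (B * T) - T * 1\<^sub>m m"
      unfolding D_def using T B by (intro mult_minus_distrib_mat) auto
    also have "T * (B * T) = T"
      using T B TB by (simp flip: assoc_mult_mat)
    finally have TD: "T * D = 0\<^sub>m n m" using T by simp
    have "col D j = 0\<^sub>v m" if j: "j < m" for j
    proof (rule ccontr)
      assume ne: "col D j \<noteq> 0\<^sub>v m"
      have "T *\<^sub>v col D j = col (T * D) j"
        using col_mult2[OF T(1) D j] by simp
      also have "\<dots> = 0\<^sub>v n" using TD j by simp
      finally have "T = 0\<^sub>m n m"
        using intertwiner_kernel[OF G \<rho>' \<sigma> T(1) int _ ne] D by auto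
      then show False using T by simp
    qed
    then have "D = 0\<^sub>m m m"
      using D by (intro mat_col_eqI) auto
    then show ?thesis
      using B T D unfolding D_def by (intro eq_matI) (auto simp: mat_eq_iff)
  qed
  have "mat_trace (\<rho> g) = mat_trace (\<sigma> g)" if g: "g \<in> carrier G" for g
  proof -
    have "mat_trace (\<rho> g) = mat_trace ((\<rho> g * T) * B)"
      using r(1)[OF g] T B TB by (simp add: assoc_mult_mat[of _ n n _ m _ n])
    also have "\<dots> = mat_trace (B * (T * \<sigma> g))"
      unfolding int[OF g] using T B s(1)[OF g] by (intro mat_trace_comm) auto
    also have "B * (T * \<sigma> g) = \<sigma> g"
      using T B s(1)[OF g] BT by (simp flip: assoc_mult_mat)
    finally show ?thesis .
  qed
  then show ?thesis by (auto simp: rep_character_def restrict_def)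
qed

text \<open>The second half of Schur's lemma: subtracting an eigenvalue from \<open>T\<close> leaves an intertwiner with
  nontrivial kernel.\<close>

lemma Schur_scalar:
  assumes G: "group G" and \<rho>: "irreducible_rep G n \<rho>"
    and T: "T \<in> carrier_mat n n"
    and int: "\<And>g. g \<in> carrier G \<Longrightarrow> \<rho> g * T = T * \<rho> g"
  shows "\<exists>c. T = c \<cdot>\<^sub>m 1\<^sub>m n"
proof -
  have \<rho>': "matrix_rep G n \<rho>" and n: "n > 0"
    using \<rho> by (auto simp: irreducible_rep_def)
  note r = matrix_repD[OF G \<rho>']
  obtain c v where ev: "eigenvector T v c"
    using spectrum_non_empty[OF T n] by (auto simp: spectrum_def eigenvalue_def)
  then have v: "v \<in> carrier_vec n" "v \<noteq> 0\<^sub>v n" "T *\<^sub>v v = c \<cdot>\<^sub>v v"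
    using T by (auto simp: eigenvector_def)
  define D where "D = T - c \<cdot>\<^sub>m 1\<^sub>m n"
  have D: "D \<in> carrier_mat n n" using T by (auto simp: D_def)
  have "D = 0\<^sub>m n n"
  proof (rule intertwiner_kernel[OF G \<rho>' \<rho> D _ v(1,2)])
    show "\<rho> g * D = D * \<rho> g" if g: "g \<in> carrier G" for g
      unfolding D_def using T r(1)[OF g] int[OF g]
      by (simp add: mult_minus_distrib_mat minus_mult_distrib_mat[of _ n n] mult_smult_distrib[of _ n n _ n]
          mult_smult_assoc_mat[of _ n n _ n])
    have "D *\<^sub>v v = T *\<^sub>v v - (c \<cdot>\<^sub>m 1\<^sub>m n) *\<^sub>v v"
      unfolding D_def using T v by (intro minus_mult_distrib_mat_vec) auto
    also have "(c \<cdot>\<^sub>m 1\<^sub>m n) *\<^sub>v v = c \<cdot>\<^sub>v v"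
      using v by (auto simp: scalar_prod_left_unit intro!: eq_vecI)
    finally show "D *\<^sub>v v = 0\<^sub>v n" using v by simp
  qed
  then have "T = c \<cdot>\<^sub>m 1\<^sub>m n"
    using T unfolding D_def by (intro eq_matI) (auto simp: mat_eq_iff)
  then show ?thesis by blast
qed

section \<open>Functions constant on the blocks of a partition\<close>

interpretation fun_space: vector_space "\<lambda>(c :: complex) (f :: 'x \<Rightarrow> complex) x. c * f x"
  by unfold_locales (auto simp: fun_eq_iff algebra_simps)

lemma sum_fun_apply: "(\<Sum>i\<in>I. f i) x = (\<Sum>i\<in>I. f i x)" for f :: "'i \<Rightarrow> 'x \<Rightarrow> complex"
  by (induction I rule: infinite_finite_induct) auto

text \<open>The indicators of the blocks span the functions that are constant on blocks, so the dimension of this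
  space is at most \<open>card \<Y>\<close>. A linearly independent family of such functions therefore has at most
  \<open>card \<Y>\<close> members, and it spans the space if it has exactly that many. The family may take arbitrary
  values outside \<open>\<Omega>\<close>; in the proof the functions are replaced by their extension by zero.\<close>

lemma block_constant_functions:
  fixes \<sigma> :: "'i \<Rightarrow> 'x \<Rightarrow> complex"
  assumes part: "partition_on \<Omega> \<Y>" and fin: "finite \<Y>" "finite I"
    and const: "\<And>i C g h. i \<in> I \<Longrightarrow> C \<in> \<Y> \<Longrightarrow> g \<in> C \<Longrightarrow> h \<in> C \<Longrightarrow> \<sigma> i g = \<sigma> i h"
    and indep: "\<And>c i. (\<And>g. g \<in> \<Omega> \<Longrightarrow> (\<Sum>i\<in>I. c i * \<sigma> i g) = 0) \<Longrightarrow> i \<in> I \<Longrightarrow> c i = 0"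
  shows "card I \<le> card \<Y>"
    and "card I = card \<Y> \<Longrightarrow> (\<And>C g h. C \<in> \<Y> \<Longrightarrow> g \<in> C \<Longrightarrow> h \<in> C \<Longrightarrow> f g = f h)
      \<Longrightarrow> \<exists>c. \<forall>g\<in>\<Omega>. f g = (\<Sum>i\<in>I. c i * \<sigma> i g)"
proof -
  define ext where "ext f = (\<lambda>g. if g \<in> \<Omega> then f g else 0)" for f :: "'x \<Rightarrow> complex"
  define ind where "ind C = (\<lambda>g. if g \<in> C then 1 else 0 :: complex)" for C :: "'x set"
  let ?T = "ind ` \<Y>" and ?S = "(\<lambda>i. ext (\<sigma> i)) ` I"
  have span_T: "ext f \<in> fun_space.span ?T"
    if f: "\<And>C g h. C \<in> \<Y> \<Longrightarrow> g \<in> C \<Longrightarrow> h \<in> C \<Longrightarrow> f g = f h" for f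
  proof -
    have "ext f = (\<Sum>C\<in>\<Y>. (\<lambda>x. f (SOME g. g \<in> C) * ind C x))"
    proof
      fix x
      show "ext f x = (\<Sum>C\<in>\<Y>. (\<lambda>x. f (SOME g. g \<in> C) * ind C x)) x"
      proof (cases "x \<in> \<Omega>")
        case True
        then obtain C where C: "C \<in> \<Y>" "x \<in> C" using part by (auto simp: partition_on_def)
        have "x \<notin> D" if "D \<in> \<Y> - {C}" for D
          using that C part by (auto simp: partition_on_def disjoint_def)
        then have "(\<Sum>D\<in>\<Y>. f (SOME g. g \<in> D) * ind D x) = (\<Sum>D\<in>{C}. f (SOME g. g \<in> D) * ind D x)"
          using C fin by (intro sum.mono_neutral_right) (auto simp: ind_def)
        also have "\<dots> = f x"
          using C f[OF C(1) someI[of "\<lambda>g. g \<in> C", OF C(2)] C(2)] by (simp add: ind_def)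
        finally show ?thesis using True by (simp add: ext_def sum_fun_apply)
      next
        case False
        then have "x \<notin> C" if "C \<in> \<Y>" for C using that part by (auto simp: partition_on_def)
        then show ?thesis using False by (simp add: ext_def ind_def sum_fun_apply)
      qed
    qed
    also have "\<dots> \<in> fun_space.span ?T"
      by (intro fun_space.span_sum fun_space.span_scale fun_space.span_base) auto
    finally show ?thesis .
  qed
  have inj: "inj_on (\<lambda>i. ext (\<sigma> i)) I"
  proof (rule inj_onI, rule ccontr)
    fix i j assume ij: "i \<in> I" "j \<in> I" "ext (\<sigma> i) = ext (\<sigma> j)" "i \<noteq> j"
    \<comment> \<open>the coefficients of the relation \<open>\<sigma> i - \<sigma> j = 0\<close>\<close>
    define c where "c k = (if k = i then 1 else if k = j then - 1 else 0 :: complex)" for k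
    have "(\<Sum>k\<in>I. c k * \<sigma> k g) = 0" if g: "g \<in> \<Omega>" for g
    proof -
      have "\<sigma> i g = \<sigma> j g" using fun_cong[OF ij(3), of g] g by (simp add: ext_def)
      moreover have "(\<Sum>k\<in>I. c k * \<sigma> k g) = (\<Sum>k\<in>{i, j}. c k * \<sigma> k g)"
      proof (rule sum.mono_neutral_right[OF fin(2)])
        show "{i, j} \<subseteq> I" using ij(1,2) by simp
        show "\<forall>k\<in>I - {i, j}. c k * \<sigma> k g = 0" by (simp add: c_def)
      qed
      moreover have "(\<Sum>k\<in>{i, j}. c k * \<sigma> k g) = \<sigma> i g - \<sigma> j g"
        using ij(4) by (simp add: c_def)
      ultimately show ?thesis by simp
    qed
    then have "c i = 0" by (rule indep[OF _ ij(1)])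
    then show False by (simp add: c_def)
  qed
  have sum_S: "(\<Sum>v\<in>?S. u v * v g) = (\<Sum>i\<in>I. u (ext (\<sigma> i)) * \<sigma> i g)" if "g \<in> \<Omega>" for u g
    using that by (subst sum.reindex[OF inj]) (auto simp: ext_def intro!: sum.cong)
  have indS: "fun_space.independent ?S"
  proof (rule fun_space.independent_if_scalars_zero)
    show "finite ?S" using fin by simp
    fix u v assume 0: "(\<Sum>v\<in>?S. (\<lambda>x. u v * v x)) = 0" and v: "v \<in> ?S"
    obtain i where i: "i \<in> I" "v = ext (\<sigma> i)" using v by auto
    have "u (ext (\<sigma> i)) = 0"
    proof (rule indep[OF _ i(1)])
      fix g assume g: "g \<in> \<Omega>"
      have "0 = (\<Sum>v\<in>?S. u v * v g)" using fun_cong[OF 0, of g] by (simp add: sum_fun_apply)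
      then show "(\<Sum>i\<in>I. u (ext (\<sigma> i)) * \<sigma> i g) = 0"
        using g by (simp add: sum_S)
    qed
    then show "u v = 0" using i by simp
  qed
  have S_T: "?S \<subseteq> fun_space.span ?T"
  proof (rule image_subsetI)
    show "ext (\<sigma> i) \<in> fun_space.span ?T" if "i \<in> I" for i
      by (rule span_T) (rule const[OF that])
  qed
  have finT: "finite ?T" and cardT: "card ?T \<le> card \<Y>" using fin by (auto intro: card_image_le)
  have cardS: "card ?S = card I" by (rule card_image[OF inj])
  show "card I \<le> card \<Y>"
    using fun_space.independent_span_bound[OF finT indS S_T] cardT cardS by simp
  assume eq: "card I = card \<Y>"
    and f: "\<And>C g h. C \<in> \<Y> \<Longrightarrow> g \<in> C \<Longrightarrow> h \<in> C \<Longrightarrow> f g = f h"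
  have f_T: "ext f \<in> fun_space.span ?T" by (rule span_T) (rule f)
  have "ext f \<in> fun_space.span ?S"
  proof (rule ccontr)
    assume out: "ext f \<notin> fun_space.span ?S"
    have "ext f \<notin> ?S" using out fun_space.span_base[of "ext f" ?S] by argo
    then have "card (insert (ext f) ?S) = Suc (card ?S)" using fin by simp
    moreover have "fun_space.independent (insert (ext f) ?S)"
      using out indS by (simp add: fun_space.independent_insert)
    ultimately have "Suc (card ?S) \<le> card ?T"
      using fun_space.independent_span_bound[OF finT, of "insert (ext f) ?S"] S_T f_T by simp
    then show False using cardT cardS eq by simp
  qed
  then obtain u where u: "ext f = (\<Sum>v\<in>?S. (\<lambda>x. u v * v x))"
    using fun_space.span_finite[of ?S] fin by auto
  show "\<exists>c. \<forall>g\<in>\<Omega>. f g = (\<Sum>i\<in>I. c i * \<sigma> i g)"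
  proof (intro exI ballI)
    fix g assume g: "g \<in> \<Omega>"
    have "ext f g = (\<Sum>v\<in>?S. u v * v g)" unfolding u by (simp add: sum_fun_apply)
    then show "f g = (\<Sum>i\<in>I. u (ext (\<sigma> i)) * \<sigma> i g)"
      using g sum_S[OF g, of u] by (simp add: ext_def)
  qed
qed

section \<open>Orthogonality of irreducible characters\<close>

locale finite_group = group G for G (structure) +
  assumes finite_carrier: "finite (carrier G)"
begin

lemma sum_translate_left:
  assumes "h \<in> carrier G"
  shows "(\<Sum>a\<in>carrier G. f (h \<otimes> a)) = (\<Sum>a\<in>carrier G. f a)"
  by (rule sum.reindex_bij_witness[of _ "\<lambda>a. inv h \<otimes> a" "\<lambda>a. h \<otimes> a"])
    (use assms in \<open>auto simp flip: m_assoc\<close>)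

text \<open>The average $\sum_a \rho(a)\, E_{jk}\, \sigma(a^{-1})$ of the matrix unit $E_{jk}$ over the group,
  which is an intertwiner from \<open>\<sigma>\<close> to \<open>\<rho>\<close>.\<close>

definition averaged :: "nat \<Rightarrow> nat \<Rightarrow> ('a \<Rightarrow> complex mat) \<Rightarrow> ('a \<Rightarrow> complex mat) \<Rightarrow> nat \<Rightarrow> nat \<Rightarrow> complex mat"
  where "averaged n m \<rho> \<sigma> j k =
    Matrix.mat n m (\<lambda>(i, l). \<Sum>a\<in>carrier G. \<rho> a $$ (i, j) * \<sigma> (inv a) $$ (k, l))"

lemma averaged_intertwines:
  assumes \<rho>: "matrix_rep G n \<rho>" and \<sigma>: "matrix_rep G m \<sigma>"
    and j: "j < n" and k: "k < m" and h: "h \<in> carrier G"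
  shows "\<rho> h * averaged n m \<rho> \<sigma> j k = averaged n m \<rho> \<sigma> j k * \<sigma> h"
proof (rule eq_matI)
  note r = matrix_repD[OF is_group \<rho>] and s = matrix_repD[OF is_group \<sigma>]
  let ?T = "averaged n m \<rho> \<sigma> j k"
  have T: "?T \<in> carrier_mat n m" by (simp add: averaged_def)
  show "dim_row (\<rho> h * ?T) = dim_row (?T * \<sigma> h)" "dim_col (\<rho> h * ?T) = dim_col (?T * \<sigma> h)"
    using r(1)[OF h] s(1)[OF h] T by auto
  fix i l assume "i < dim_row (?T * \<sigma> h)" "l < dim_col (?T * \<sigma> h)"
  then have i: "i < n" and l: "l < m" using s(1)[OF h] T by auto
  have "(\<rho> h * ?T) $$ (i, l)
      = (\<Sum>p<n. \<rho> h $$ (i, p) * (\<Sum>a\<in>carrier G. \<rho> a $$ (p, j) * \<sigma> (inv a) $$ (k, l)))"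
    using mat_mult_entry[OF r(1)[OF h] T i l] l by (simp add: averaged_def)
  also have "\<dots> = (\<Sum>a\<in>carrier G. (\<Sum>p<n. \<rho> h $$ (i, p) * \<rho> a $$ (p, j)) * \<sigma> (inv a) $$ (k, l))"
    by (simp add: sum_distrib_left sum_distrib_right mult.assoc sum.swap[of _ "{..<n}"])
  also have "\<dots> = (\<Sum>a\<in>carrier G. \<rho> (h \<otimes> a) $$ (i, j) * \<sigma> (inv a) $$ (k, l))"
    using mat_mult_entry[OF r(1)[OF h] r(1) i j] h by (simp add: r(2))
  also have "\<dots> = (\<Sum>a\<in>carrier G. \<rho> (h \<otimes> a) $$ (i, j) * \<sigma> (inv (h \<otimes> a) \<otimes> h) $$ (k, l))"
    using h by (intro sum.cong) (auto simp: inv_mult_group m_assoc)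
  also have "\<dots> = (\<Sum>a\<in>carrier G. \<rho> a $$ (i, j) * \<sigma> (inv a \<otimes> h) $$ (k, l))"
    using sum_translate_left[OF h, of "\<lambda>a. \<rho> a $$ (i, j) * \<sigma> (inv a \<otimes> h) $$ (k, l)"] by simp
  also have "\<dots> = (\<Sum>a\<in>carrier G. \<rho> a $$ (i, j) * (\<Sum>q<m. \<sigma> (inv a) $$ (k, q) * \<sigma> h $$ (q, l)))"
    using mat_mult_entry[OF s(1) s(1)[OF h] k l] h by (simp add: s(2))
  also have "\<dots> = (\<Sum>q<m. (\<Sum>a\<in>carrier G. \<rho> a $$ (i, j) * \<sigma> (inv a) $$ (k, q)) * \<sigma> h $$ (q, l))"
    by (simp add: sum_distrib_left sum_distrib_right mult.assoc sum.swap[of _ "{..<m}"])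
  also have "\<dots> = (?T * \<sigma> h) $$ (i, l)"
    using mat_mult_entry[OF T s(1)[OF h] i l] i by (simp add: averaged_def)
  finally show "(\<rho> h * ?T) $$ (i, l) = (?T * \<sigma> h) $$ (i, l)" .
qed

lemma entries_orthogonal_inequivalent:
  assumes \<rho>: "irreducible_rep G n \<rho>" and \<sigma>: "irreducible_rep G m \<sigma>"
    and ne: "rep_character G \<rho> \<noteq> rep_character G \<sigma>"
    and ij: "i < n" "j < n" and kl: "k < m" "l < m"
  shows "(\<Sum>a\<in>carrier G. \<rho> a $$ (i, j) * \<sigma> (inv a) $$ (k, l)) = 0"
proof -
  have "matrix_rep G n \<rho>" "matrix_rep G m \<sigma>"
    using \<rho> \<sigma> by (auto simp: irreducible_rep_def)
  then have "averaged n m \<rho> \<sigma> j k = 0\<^sub>m n m"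
    using nonzero_intertwiner_imp_same_character[OF is_group \<rho> \<sigma>, of "averaged n m \<rho> \<sigma> j k"] ne
      averaged_intertwines ij kl by (auto simp: averaged_def)
  then have "averaged n m \<rho> \<sigma> j k $$ (i, l) = 0" using ij kl by simp
  then show ?thesis using ij kl by (simp add: averaged_def)
qed

text \<open>By Schur's lemma the averaged matrix unit is a scalar \<open>c\<close>, and \<open>c\<close> is found by comparing traces:
  the trace of the average of $E_{jk}$ is $|G|$ times that of $E_{jk}$.\<close>

lemma entries_orthogonal:
  assumes \<rho>: "irreducible_rep G n \<rho>" and ij: "i < n" "j < n" and kl: "k < n" "l < n"
  shows "(\<Sum>a\<in>carrier G. \<rho> a $$ (i, j) * \<rho> (inv a) $$ (k, l))
    = (if i = l \<and> j = k then of_nat (card (carrier G)) / of_nat n else 0)"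
proof -
  have \<rho>': "matrix_rep G n \<rho>" using \<rho> by (auto simp: irreducible_rep_def)
  note r = matrix_repD[OF is_group \<rho>']
  let ?T = "averaged n n \<rho> \<rho> j k"
  obtain c where c: "?T = c \<cdot>\<^sub>m 1\<^sub>m n"
    using Schur_scalar[OF is_group \<rho>, of ?T] averaged_intertwines[OF \<rho>' \<rho>'] ij kl
    by (auto simp: averaged_def)
  have entry: "(\<Sum>a\<in>carrier G. \<rho> a $$ (i, j) * \<rho> (inv a) $$ (k, l)) = (if i = l then c else 0)"
    if "i < n" "l < n" for i l
    using arg_cong[OF c, of "\<lambda>A. A $$ (i, l)"] that by (simp add: averaged_def)
  have "of_nat n * c = (\<Sum>i<n. \<Sum>a\<in>carrier G. \<rho> a $$ (i, j) * \<rho> (inv a) $$ (k, i))"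
    by (simp add: entry)
  also have "\<dots> = (\<Sum>a\<in>carrier G. \<Sum>i<n. \<rho> (inv a) $$ (k, i) * \<rho> a $$ (i, j))"
    by (subst sum.swap) (simp add: mult.commute)
  also have "\<dots> = (\<Sum>a\<in>carrier G. (\<rho> (inv a) * \<rho> a) $$ (k, j))"
    using mat_mult_entry[OF r(1) r(1) kl(1) ij(2)] by simp
  also have "\<dots> = (\<Sum>a\<in>carrier G. if j = k then 1 else 0)"
    using ij kl r(3) by (intro sum.cong) (auto simp flip: r(2))
  finally have "of_nat n * c = (if j = k then of_nat (card (carrier G)) else 0)" by simp
  then have "c = (if j = k then of_nat (card (carrier G)) / of_nat n else 0)"
    using ij by (auto simp: field_simps split: if_splits)
  then show ?thesis using entry[OF ij(1) kl(2)] by auto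
qed

definition convolve :: "('a \<Rightarrow> complex) \<Rightarrow> ('a \<Rightarrow> complex) \<Rightarrow> 'a \<Rightarrow> complex" where
  "convolve f h g = (\<Sum>a\<in>carrier G. f a * h (inv a \<otimes> g))"

lemma convolve_trace:
  assumes \<rho>: "matrix_rep G n \<rho>" and \<sigma>: "matrix_rep G m \<sigma>" and g: "g \<in> carrier G"
  shows "convolve (rep_character G \<rho>) (rep_character G \<sigma>) g
    = (\<Sum>i<n. \<Sum>k<m. \<Sum>l<m. (\<Sum>a\<in>carrier G. \<rho> a $$ (i, i) * \<sigma> (inv a) $$ (k, l)) * \<sigma> g $$ (l, k))"
proof -
  note r = matrix_repD[OF is_group \<rho>] and s = matrix_repD[OF is_group \<sigma>]
  have "convolve (rep_character G \<rho>) (rep_character G \<sigma>) g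
      = (\<Sum>a\<in>carrier G. (\<Sum>i<n. \<rho> a $$ (i, i)) * (\<Sum>k<m. (\<sigma> (inv a) * \<sigma> g) $$ (k, k)))"
    unfolding convolve_def
  proof (rule sum.cong[OF refl])
    fix a assume a: "a \<in> carrier G"
    have "dim_row (\<rho> a) = n" "dim_row (\<sigma> (inv a) * \<sigma> g) = m"
      using r(1)[OF a] s(1)[of "inv a"] a by auto
    then show "rep_character G \<rho> a * rep_character G \<sigma> (inv a \<otimes> g) =
      (\<Sum>i<n. \<rho> a $$ (i, i)) * (\<Sum>k<m. (\<sigma> (inv a) * \<sigma> g) $$ (k, k))"
      using a g by (simp add: rep_character_def mat_trace_def s(2))
  qed
  also have "\<dots> = (\<Sum>a\<in>carrier G. \<Sum>i<n. \<Sum>k<m. \<Sum>l<m. \<rho> a $$ (i, i) * \<sigma> (inv a) $$ (k, l) * \<sigma> g $$ (l, k))"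
  proof (rule sum.cong[OF refl])
    fix a assume a: "a \<in> carrier G"
    have "(\<Sum>k<m. (\<sigma> (inv a) * \<sigma> g) $$ (k, k)) = (\<Sum>k<m. \<Sum>l<m. \<sigma> (inv a) $$ (k, l) * \<sigma> g $$ (l, k))"
      using mat_mult_entry[OF s(1) s(1)[OF g], of "inv a"] a by simp
    then show "(\<Sum>i<n. \<rho> a $$ (i, i)) * (\<Sum>k<m. (\<sigma> (inv a) * \<sigma> g) $$ (k, k))
      = (\<Sum>i<n. \<Sum>k<m. \<Sum>l<m. \<rho> a $$ (i, i) * \<sigma> (inv a) $$ (k, l) * \<sigma> g $$ (l, k))"
      by (simp only: sum_product) (simp add: sum_distrib_left mult.assoc)
  qed
  also have "\<dots> = (\<Sum>i<n. \<Sum>k<m. \<Sum>l<m. \<Sum>a\<in>carrier G. \<rho> a $$ (i, i) * \<sigma> (inv a) $$ (k, l) * \<sigma> g $$ (l, k))"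
    by (simp only: sum.swap[of _ _ "carrier G"])
  finally show ?thesis by (simp add: sum_distrib_right)
qed

lemma rep_character_one:
  assumes "matrix_rep G n \<rho>"
  shows "rep_character G \<rho> \<one> = of_nat n"
  using matrix_repD(3)[OF is_group assms] by (simp add: rep_character_def mat_trace_def)

text \<open>The convolution of two characters is a sum of the products of matrix entries that are evaluated by
  the orthogonality relations above. Compared with orthogonality for the inner product, which is the
  value at \<open>\<one>\<close>, the convolution form says that the characters are idempotents up to scaling.\<close>

lemma Irr_convolve:
  assumes "\<chi> \<in> Irr G" "\<psi> \<in> Irr G" and g: "g \<in> carrier G"
  shows "convolve \<chi> \<psi> g = (if \<chi> = \<psi> then of_nat (card (carrier G)) / \<chi> \<one> * \<chi> g else 0)"
proof -
  obtain n \<rho> where \<rho>: "irreducible_rep G n \<rho>" "\<chi> = rep_character G \<rho>"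
    using assms(1) by (auto simp: Irr_def)
  have \<rho>': "matrix_rep G n \<rho>" using \<rho> by (simp add: irreducible_rep_def)
  show ?thesis
  proof (cases "\<chi> = \<psi>")
    case True
    let ?c = "of_nat (card (carrier G)) / of_nat n :: complex"
    have "convolve \<chi> \<psi> g = (\<Sum>i<n. \<Sum>k<n. \<Sum>l<n. (if i = l \<and> i = k then ?c else 0) * \<rho> g $$ (l, k))"
      unfolding True[symmetric] \<rho>(2) convolve_trace[OF \<rho>' \<rho>' g]
      by (intro sum.cong refl) (simp add: entries_orthogonal[OF \<rho>(1)])
    also have "\<dots> = (\<Sum>i<n. \<Sum>k<n. \<Sum>l<n. if l = i then if k = i then ?c * \<rho> g $$ (i, i) else 0 else 0)"
      by (intro sum.cong refl) auto
    also have "\<dots> = (\<Sum>i<n. ?c * \<rho> g $$ (i, i))"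
      by (intro sum.cong refl) (simp add: sum.delta)
    also have "\<dots> = ?c * mat_trace (\<rho> g)"
      using matrix_repD(1)[OF is_group \<rho>' g] by (simp add: mat_trace_def sum_distrib_left)
    finally have "convolve \<chi> \<psi> g = ?c * mat_trace (\<rho> g)" .
    moreover have "mat_trace (\<rho> g) = \<chi> g" using \<rho>(2) g by (simp add: rep_character_def)
    moreover have "\<chi> \<one> = of_nat n" using \<rho>(2) rep_character_one[OF \<rho>'] by simp
    ultimately show ?thesis using True by simp
  next
    case False
    obtain m \<sigma> where \<sigma>: "irreducible_rep G m \<sigma>" "\<psi> = rep_character G \<sigma>"
      using assms(2) by (auto simp: Irr_def)
    have \<sigma>': "matrix_rep G m \<sigma>" using \<sigma> by (simp add: irreducible_rep_def)
    have "convolve \<chi> \<psi> g = 0"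
      unfolding \<rho>(2) \<sigma>(2) convolve_trace[OF \<rho>' \<sigma>' g]
      using entries_orthogonal_inequivalent[OF \<rho>(1) \<sigma>(1)] False \<rho>(2) \<sigma>(2)
      by (intro sum.neutral ballI) simp
    then show ?thesis using False by simp
  qed
qed

lemma Irr_one_pos:
  assumes "\<chi> \<in> Irr G"
  shows "\<exists>n>0. \<chi> \<one> = of_nat n"
  using assms rep_character_one by (auto simp: Irr_def irreducible_rep_def)

lemma Irr_conj:
  assumes "\<chi> \<in> Irr G" "g \<in> carrier G" "h \<in> carrier G"
  shows "\<chi> (h \<otimes> g \<otimes> inv h) = \<chi> g"
proof -
  obtain n \<rho> where \<rho>: "irreducible_rep G n \<rho>" "\<chi> = rep_character G \<rho>"
    using assms(1) by (auto simp: Irr_def)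
  have \<rho>': "matrix_rep G n \<rho>" using \<rho> by (simp add: irreducible_rep_def)
  note r = matrix_repD[OF is_group \<rho>']
  have "mat_trace (\<rho> (h \<otimes> g \<otimes> inv h)) = mat_trace (\<rho> (h \<otimes> g) * \<rho> (inv h))"
    using assms by (simp add: r(2))
  also have "\<dots> = mat_trace (\<rho> (inv h) * \<rho> (h \<otimes> g))"
    using assms by (intro mat_trace_comm[of _ n n] r(1)) auto
  also have "\<rho> (inv h) * \<rho> (h \<otimes> g) = \<rho> g"
    using assms by (simp flip: r(2) m_assoc)
  finally show ?thesis using assms by (simp add: \<rho>(2) rep_character_def)
qed

lemma Irr_inverse:
  assumes "\<chi> \<in> Irr G" and g: "g \<in> carrier G"
  shows "\<chi> (inv g) = cnj (\<chi> g)"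
proof -
  obtain n \<rho> where \<rho>: "irreducible_rep G n \<rho>" "\<chi> = rep_character G \<rho>"
    using assms(1) by (auto simp: Irr_def)
  have \<rho>': "matrix_rep G n \<rho>" using \<rho> by (simp add: irreducible_rep_def)
  note r = matrix_repD[OF is_group \<rho>']
  let ?N = "Coset.order G"
  have N: "?N > 0" using finite_carrier order_gt_0_iff_finite by blast
  have pow: "\<rho> (g [^] k) = \<rho> g ^\<^sub>m k" for k :: nat
    by (induction k) (use r g in \<open>auto\<close>)
  have one: "g [^] ?N = \<one>" using g by (rule pow_order_eq_1)
  have "inv g = g [^] (?N - 1)"
  proof (rule inv_equality)
    show "g [^] (?N - 1) \<otimes> g = \<one>"
      using one N nat_pow_Suc[of g "?N - 1"] by simp
  qed (use g in auto)
  moreover have "\<rho> g ^\<^sub>m ?N = 1\<^sub>m n" using pow[of ?N] one r(3) by simp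
  ultimately have "mat_trace (\<rho> (inv g)) = cnj (mat_trace (\<rho> g))"
    using trace_finite_order[OF r(1)[OF g] _ N] pow[of "?N - 1"] by simp
  then show ?thesis using g by (simp add: \<rho>(2) rep_character_def)
qed

lemma convolve_cong:
  assumes "\<And>a. a \<in> carrier G \<Longrightarrow> f a = f' a" "\<And>a. a \<in> carrier G \<Longrightarrow> h a = h' a" "g \<in> carrier G"
  shows "convolve f h g = convolve f' h' g"
  unfolding convolve_def using assms by (intro sum.cong) auto

lemma convolve_sum_left:
  "convolve (\<lambda>a. \<Sum>i\<in>I. c i * f i a) h g = (\<Sum>i\<in>I. c i * convolve (f i) h g)"
  unfolding convolve_def
  by (simp add: sum_distrib_left sum_distrib_right mult.assoc sum.swap[of _ "carrier G"])

lemma convolve_sum_right: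
  "convolve f (\<lambda>a. \<Sum>i\<in>I. c i * h i a) g = (\<Sum>i\<in>I. c i * convolve f (h i) g)"
  unfolding convolve_def
  by (simp add: sum_distrib_left mult.left_commute sum.swap[of _ "carrier G"])

lemma card_carrier_pos: "card (carrier G) > 0"
  using finite_carrier by (auto simp: card_gt_0_iff)

lemma Irr_independent:
  assumes F: "F \<subseteq> Irr G" "finite F"
    and zero: "\<And>g. g \<in> carrier G \<Longrightarrow> (\<Sum>\<chi>\<in>F. c \<chi> * \<chi> g) = 0" and \<psi>: "\<psi> \<in> F"
  shows "c \<psi> = 0"
proof -
  have "0 = convolve (\<lambda>g. \<Sum>\<chi>\<in>F. c \<chi> * \<chi> g) \<psi> \<one>"
    using zero by (simp add: convolve_def)
  also have "\<dots> = (\<Sum>\<chi>\<in>F. c \<chi> * convolve \<chi> \<psi> \<one>)"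
    by (rule convolve_sum_left)
  also have "\<dots> = (\<Sum>\<chi>\<in>F. if \<chi> = \<psi> then c \<psi> * of_nat (card (carrier G)) else 0)"
  proof (intro sum.cong refl)
    fix \<chi> assume "\<chi> \<in> F"
    then have "\<chi> \<in> Irr G" "\<psi> \<in> Irr G" "\<psi> \<one> \<noteq> 0" using F \<psi> Irr_one_pos[of \<psi>] by auto
    then show "c \<chi> * convolve \<chi> \<psi> \<one> = (if \<chi> = \<psi> then c \<psi> * of_nat (card (carrier G)) else 0)"
      by (simp add: Irr_convolve)
  qed
  also have "\<dots> = c \<psi> * of_nat (card (carrier G))"
    using F \<psi> by simp
  finally show ?thesis using card_carrier_pos by simp
qed

text \<open>Irreducible characters are linearly independent functions on a finite set.\<close>

lemma finite_Irr: "finite (Irr G)"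
proof -
  have part: "partition_on (carrier G) ((\<lambda>g. {g}) ` carrier G)"
    by (auto simp: partition_on_def disjoint_def)
  have "card F \<le> card ((\<lambda>g. {g}) ` carrier G)" if "F \<subseteq> Irr G" "finite F" for F
  proof (rule block_constant_functions(1)[OF part _ that(2), where \<sigma> = "\<lambda>\<chi>. \<chi>"])
    show "finite ((\<lambda>g. {g}) ` carrier G)" by (simp add: finite_carrier)
    show "c \<psi> = 0" if "\<And>g. g \<in> carrier G \<Longrightarrow> (\<Sum>\<chi>\<in>F. c \<chi> * \<chi> g) = 0" "\<psi> \<in> F" for c \<psi>
      by (rule Irr_independent[OF \<open>F \<subseteq> Irr G\<close> \<open>finite F\<close> that])
  qed auto
  then show ?thesis
    by (intro finite_if_finite_subsets_card_bdd[THEN conjunct1]) blast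
qed

end

section \<open>The algebra of superclass functions\<close>

locale supercharacters = finite_group G for G (structure) +
  fixes S :: "'a super_theory"
  assumes supercharacter_theory: "supercharacter_theory G S"
begin

abbreviation \<sigma> :: "('a \<Rightarrow> complex) set \<Rightarrow> 'a \<Rightarrow> complex" where "\<sigma> \<equiv> super_sigma G"

lemma partition_Irr: "partition_on (Irr G) (fst S)"
  and partition_classes: "partition_on (carrier G) (snd S)"
  and one_class: "{\<one>} \<in> snd S"
  and card_parts: "card (fst S) = card (snd S)"
  and \<sigma>_constant: "\<And>X C g h. X \<in> fst S \<Longrightarrow> C \<in> snd S \<Longrightarrow> g \<in> C \<Longrightarrow> h \<in> C \<Longrightarrow> \<sigma> X g = \<sigma> X h"
proof -
  note def = supercharacter_theory[unfolded supercharacter_theory_def case_prod_beta]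
  show "partition_on (Irr G) (fst S)" "partition_on (carrier G) (snd S)" "{\<one>} \<in> snd S"
    "card (fst S) = card (snd S)"
    using def by simp_all
  show "\<And>X C g h. X \<in> fst S \<Longrightarrow> C \<in> snd S \<Longrightarrow> g \<in> C \<Longrightarrow> h \<in> C \<Longrightarrow> \<sigma> X g = \<sigma> X h"
    using def by blast
qed

lemma finite_parts: "finite (fst S)" "finite (snd S)"
  using partition_Irr partition_classes finite_Irr finite_carrier
  by (auto intro: finite_elements)

lemma part_Irr: "X \<in> fst S \<Longrightarrow> X \<subseteq> Irr G" "X \<in> fst S \<Longrightarrow> finite X" "X \<in> fst S \<Longrightarrow> X \<noteq> {}"
  using partition_Irr finite_Irr by (auto simp: partition_on_def intro: finite_subset)

lemma \<sigma>_eq: "g \<in> carrier G \<Longrightarrow> \<sigma> X g = (\<Sum>\<chi>\<in>X. \<chi> \<one> * \<chi> g)"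
  by (simp add: super_sigma_def)

lemma \<sigma>_one_nonzero:
  assumes "X \<in> fst S"
  shows "\<sigma> X \<one> \<noteq> 0"
proof -
  have "\<forall>\<chi>. \<chi> \<in> X \<longrightarrow> (\<exists>n>0. \<chi> \<one> = of_nat n)"
    using part_Irr[OF assms] Irr_one_pos by blast
  then obtain d where d: "\<And>\<chi>. \<chi> \<in> X \<Longrightarrow> d \<chi> > 0 \<and> \<chi> \<one> = of_nat (d \<chi>)" by metis
  have "\<sigma> X \<one> = of_nat (\<Sum>\<chi>\<in>X. d \<chi> * d \<chi>)"
    using d by (simp add: \<sigma>_eq)
  moreover have "(\<Sum>\<chi>\<in>X. d \<chi> * d \<chi>) > 0"
    using d part_Irr[OF assms] by (intro sum_pos) auto
  ultimately show ?thesis by (simp del: of_nat_sum)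
qed

text \<open>The weights \<open>\<chi> \<one>\<close> in the definition of the $S$-characters cancel the denominators in
  \<open>Irr_convolve\<close>, so every \<open>\<sigma> X\<close>, divided by \<open>card (carrier G)\<close>, is an idempotent.\<close>

lemma \<sigma>_convolve:
  assumes X: "X \<in> fst S" "X' \<in> fst S" and g: "g \<in> carrier G"
  shows "convolve (\<sigma> X) (\<sigma> X') g = (if X = X' then of_nat (card (carrier G)) * \<sigma> X g else 0)"
proof -
  have "convolve (\<sigma> X) (\<sigma> X') g
      = convolve (\<lambda>a. \<Sum>\<chi>\<in>X. \<chi> \<one> * \<chi> a) (\<lambda>a. \<Sum>\<psi>\<in>X'. \<psi> \<one> * \<psi> a) g"
    by (rule convolve_cong[OF \<sigma>_eq \<sigma>_eq g])
  also have "\<dots> = (\<Sum>\<chi>\<in>X. \<chi> \<one> * (\<Sum>\<psi>\<in>X'. \<psi> \<one> * convolve \<chi> \<psi> g))"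
    by (simp add: convolve_sum_left convolve_sum_right)
  also have "\<dots> = (\<Sum>\<chi>\<in>X. \<chi> \<one> * (\<Sum>\<psi>\<in>X'. if \<psi> = \<chi> then of_nat (card (carrier G)) * \<chi> g else 0))"
  proof (intro sum.cong arg_cong2[of _ _ _ _ "(*)"] refl)
    fix \<chi> \<psi> assume "\<chi> \<in> X" "\<psi> \<in> X'"
    then have "\<chi> \<in> Irr G" "\<psi> \<in> Irr G" using part_Irr X by auto
    then show "\<psi> \<one> * convolve \<chi> \<psi> g = (if \<psi> = \<chi> then of_nat (card (carrier G)) * \<chi> g else 0)"
      using Irr_convolve[of \<chi> \<psi> g] Irr_one_pos[of \<chi>] g by auto
  qed
  also have "\<dots> = (\<Sum>\<chi>\<in>X. if \<chi> \<in> X' then of_nat (card (carrier G)) * (\<chi> \<one> * \<chi> g) else 0)"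
    using part_Irr X by (intro sum.cong) (auto simp: mult_ac)
  also have "\<dots> = (if X = X' then of_nat (card (carrier G)) * \<sigma> X g else 0)"
  proof (cases "X = X'")
    case True
    then show ?thesis using g by (simp add: \<sigma>_eq sum_distrib_left)
  next
    case False
    then have "X \<inter> X' = {}" using partition_Irr X by (auto simp: partition_on_def disjoint_def)
    then have "\<chi> \<notin> X'" if "\<chi> \<in> X" for \<chi> using that by auto
    then show ?thesis using False by simp
  qed
  finally show ?thesis .
qed

lemma \<sigma>_convolve_combination:
  assumes f: "\<And>g. g \<in> carrier G \<Longrightarrow> f g = (\<Sum>X\<in>fst S. c X * \<sigma> X g)"
    and X: "X \<in> fst S" and g: "g \<in> carrier G"
  shows "convolve (\<sigma> X) f g = c X * of_nat (card (carrier G)) * \<sigma> X g"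
proof -
  have "convolve (\<sigma> X) f g = (\<Sum>X'\<in>fst S. c X' * convolve (\<sigma> X) (\<sigma> X') g)"
    using convolve_cong[OF refl f g] by (simp add: convolve_sum_right)
  also have "\<dots> = (\<Sum>X'\<in>fst S. if X' = X then c X * of_nat (card (carrier G)) * \<sigma> X g else 0)"
    using X g by (intro sum.cong) (auto simp: \<sigma>_convolve)
  also have "\<dots> = c X * of_nat (card (carrier G)) * \<sigma> X g"
    using X finite_parts by simp
  finally show ?thesis .
qed

definition superclass_function :: "('a \<Rightarrow> complex) \<Rightarrow> bool" where
  "superclass_function f \<longleftrightarrow> (\<forall>C\<in>snd S. \<forall>g\<in>C. \<forall>h\<in>C. f g = f h)"

text \<open>The \<open>\<sigma> X\<close> are linearly independent, and there are as many of them as classes. The closure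
  properties of \<open>S\<close>-classes come from applying this to their indicator functions.\<close>

lemma superclass_function_expansion:
  assumes f: "superclass_function f"
  obtains c where "\<And>g. g \<in> carrier G \<Longrightarrow> f g = (\<Sum>X\<in>fst S. c X * \<sigma> X g)"
proof -
  have indep: "c X = 0"
    if zero: "\<And>g. g \<in> carrier G \<Longrightarrow> (\<Sum>X\<in>fst S. c X * \<sigma> X g) = 0" and X: "X \<in> fst S" for c X
  proof -
    have "0 = convolve (\<sigma> X) (\<lambda>_. 0) \<one>" by (simp add: convolve_def)
    also have "\<dots> = c X * of_nat (card (carrier G)) * \<sigma> X \<one>"
      using zero X by (intro \<sigma>_convolve_combination) auto
    finally show ?thesis using \<sigma>_one_nonzero[OF X] card_carrier_pos by simp
  qed
  have "\<exists>c. \<forall>g\<in>carrier G. f g = (\<Sum>X\<in>fst S. c X * \<sigma> X g)"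
  proof (rule block_constant_functions(2)[OF partition_classes finite_parts(2,1) _ _ card_parts])
    show "\<sigma> X g = \<sigma> X h" if "X \<in> fst S" "C \<in> snd S" "g \<in> C" "h \<in> C" for X C g h
      by (rule \<sigma>_constant[OF that])
    show "c X = 0" if "\<And>g. g \<in> carrier G \<Longrightarrow> (\<Sum>X\<in>fst S. c X * \<sigma> X g) = 0" "X \<in> fst S" for c X
      by (rule indep[OF that])
    show "f g = f h" if "C \<in> snd S" "g \<in> C" "h \<in> C" for C g h
      using f that unfolding superclass_function_def by blast
  qed
  then show ?thesis using that by blast
qed

lemma class_subset: "C \<in> snd S \<Longrightarrow> C \<subseteq> carrier G"
  using partition_classes by (auto simp: partition_on_def)

lemma superclass_functionI:
  assumes "\<And>g. g \<in> carrier G \<Longrightarrow> f g = (\<Sum>X\<in>fst S. c X * \<sigma> X g)"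
  shows "superclass_function f"
  unfolding superclass_function_def
proof (intro ballI)
  fix C g h assume C: "C \<in> snd S" "g \<in> C" "h \<in> C"
  then have gh: "g \<in> carrier G" "h \<in> carrier G" using class_subset by auto
  have "(\<Sum>X\<in>fst S. c X * \<sigma> X g) = (\<Sum>X\<in>fst S. c X * \<sigma> X h)"
    by (intro sum.cong refl arg_cong2[of _ _ _ _ "(*)"] \<sigma>_constant[OF _ C])
  then show "f g = f h" unfolding assms[OF gh(1)] assms[OF gh(2)] .
qed

lemma superclass_function_convolve:
  assumes f: "superclass_function f" and h: "superclass_function h"
  shows "superclass_function (convolve f h)"
proof -
  obtain c where c: "\<And>g. g \<in> carrier G \<Longrightarrow> f g = (\<Sum>X\<in>fst S. c X * \<sigma> X g)"
    using superclass_function_expansion[OF f] by metis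
  obtain d where d: "\<And>g. g \<in> carrier G \<Longrightarrow> h g = (\<Sum>X\<in>fst S. d X * \<sigma> X g)"
    using superclass_function_expansion[OF h] by metis
  have "convolve f h g = (\<Sum>X\<in>fst S. (c X * d X * of_nat (card (carrier G))) * \<sigma> X g)"
    if g: "g \<in> carrier G" for g
  proof -
    have "convolve f h g = (\<Sum>X\<in>fst S. c X * convolve (\<sigma> X) h g)"
      using convolve_cong[OF c refl g] by (simp add: convolve_sum_left)
    then show ?thesis using \<sigma>_convolve_combination[OF d _ g] by (simp add: mult_ac)
  qed
  then show ?thesis by (rule superclass_functionI)
qed

text \<open>Inversion of the argument conjugates the values of \<open>\<sigma> X\<close>, and the complex conjugate of a function that
  is constant on classes is again constant on classes.\<close>

lemma superclass_function_inverse: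
  assumes f: "superclass_function f"
  shows "superclass_function (\<lambda>g. f (inv g))"
proof -
  obtain c where c: "\<And>g. g \<in> carrier G \<Longrightarrow> f g = (\<Sum>X\<in>fst S. c X * \<sigma> X g)"
    using superclass_function_expansion[OF f] by metis
  have "\<sigma> X (inv g) = cnj (\<sigma> X g)" if "X \<in> fst S" "g \<in> carrier G" for X g
  proof -
    have "\<chi> \<one> * \<chi> (inv g) = cnj (\<chi> \<one> * \<chi> g)" if "\<chi> \<in> X" for \<chi>
    proof -
      have "\<chi> \<in> Irr G" using part_Irr(1)[OF \<open>X \<in> fst S\<close>] that by blast
      then show ?thesis using Irr_inverse[of \<chi> g] Irr_one_pos[of \<chi>] \<open>g \<in> carrier G\<close> by auto
    qed
    then show ?thesis using that by (simp add: \<sigma>_eq)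
  qed
  then have f_inv: "f (inv g) = (\<Sum>X\<in>fst S. c X * cnj (\<sigma> X g))" if "g \<in> carrier G" for g
    using that by (simp add: c)
  show ?thesis
    unfolding superclass_function_def
  proof (intro ballI)
    fix C g h assume C: "C \<in> snd S" "g \<in> C" "h \<in> C"
    then have gh: "g \<in> carrier G" "h \<in> carrier G" using class_subset by auto
    have "(\<Sum>X\<in>fst S. c X * cnj (\<sigma> X g)) = (\<Sum>X\<in>fst S. c X * cnj (\<sigma> X h))"
      by (intro sum.cong refl arg_cong2[of _ _ _ _ "(*)"] arg_cong[of _ _ cnj] \<sigma>_constant[OF _ C])
    then show "f (inv g) = f (inv h)" unfolding f_inv[OF gh(1)] f_inv[OF gh(2)] .
  qed
qed

lemma superclass_function_conj:
  assumes f: "superclass_function f" and "g \<in> carrier G" "h \<in> carrier G"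
  shows "f (h \<otimes> g \<otimes> inv h) = f g"
proof -
  obtain c where c: "\<And>g. g \<in> carrier G \<Longrightarrow> f g = (\<Sum>X\<in>fst S. c X * \<sigma> X g)"
    using superclass_function_expansion[OF f] by metis
  have "\<sigma> X (h \<otimes> g \<otimes> inv h) = \<sigma> X g" if "X \<in> fst S" for X
  proof -
    have "\<chi> (h \<otimes> g \<otimes> inv h) = \<chi> g" if "\<chi> \<in> X" for \<chi>
      using part_Irr(1)[OF \<open>X \<in> fst S\<close>] that assms(2,3) by (intro Irr_conj) auto
    then have "(\<Sum>\<chi>\<in>X. \<chi> \<one> * \<chi> (h \<otimes> g \<otimes> inv h)) = (\<Sum>\<chi>\<in>X. \<chi> \<one> * \<chi> g)"
      by (intro sum.cong refl arg_cong2[of _ _ _ _ "(*)"])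
    then show ?thesis using assms(2,3) by (simp add: \<sigma>_eq)
  qed
  then show ?thesis using assms(2,3) by (simp add: c)
qed

section \<open>\<open>S\<close>-classes and \<open>S\<close>-normal subgroups\<close>

lemma super_cl_eq:
  assumes "C \<in> snd S" "g \<in> C"
  shows "super_cl S g = C"
  unfolding super_cl_def super_classes_def
proof (rule the_equality)
  show "C \<in> snd S \<and> g \<in> C" using assms by simp
  show "D = C" if "D \<in> snd S \<and> g \<in> D" for D
    using that assms partition_classes by (auto simp: partition_on_def disjoint_def)
qed

lemma super_cl:
  assumes "g \<in> carrier G"
  shows "super_cl S g \<in> snd S" "g \<in> super_cl S g"
proof -
  obtain C where C: "C \<in> snd S" "g \<in> C"
    using assms partition_classes by (auto simp: partition_on_def)
  then show "super_cl S g \<in> snd S" "g \<in> super_cl S g" using super_cl_eq[OF C] by auto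
qed

lemma super_cl_closed: "g \<in> carrier G \<Longrightarrow> h \<in> super_cl S g \<Longrightarrow> h \<in> carrier G"
  using super_cl(1) class_subset by blast

lemma super_cl_same: "g \<in> carrier G \<Longrightarrow> h \<in> super_cl S g \<Longrightarrow> super_cl S h = super_cl S g"
  by (rule super_cl_eq[OF super_cl(1)])

lemma superclass_functionD:
  assumes "superclass_function f" "g \<in> carrier G" "h \<in> super_cl S g"
  shows "f h = f g"
  using assms super_cl[OF assms(2)] unfolding superclass_function_def by blast

lemma superclass_function_indicator:
  assumes "M \<subseteq> carrier G" "\<And>g. g \<in> M \<Longrightarrow> super_cl S g \<subseteq> M"
  shows "superclass_function (\<lambda>g. if g \<in> M then 1 else 0)"
  unfolding superclass_function_def
proof (intro ballI)
  fix C g h assume C: "C \<in> snd S" "g \<in> C" "h \<in> C"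
  have "g \<in> M \<longleftrightarrow> h \<in> M"
    using C assms(2) super_cl_eq[OF C(1,2)] super_cl_eq[OF C(1,3)] by blast
  then show "(if g \<in> M then 1 else 0 :: complex) = (if h \<in> M then 1 else 0)" by simp
qed

lemma superclass_function_class:
  assumes "g \<in> carrier G"
  shows "superclass_function (\<lambda>x. if x \<in> super_cl S g then 1 else 0)"
proof (rule superclass_function_indicator)
  show "super_cl S g \<subseteq> carrier G" using super_cl_closed[OF assms] by blast
  show "super_cl S h \<subseteq> super_cl S g" if "h \<in> super_cl S g" for h
    using super_cl_same[OF assms that] by simp
qed

lemma super_normal_iff:
  "super_normal G S M \<longleftrightarrow> subgroup M G \<and> (\<forall>g\<in>M. super_cl S g \<subseteq> M)"
proof (intro iffI conjI)
  assume M: "super_normal G S M"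
  show "subgroup M G" using M by (simp add: super_normal_def)
  obtain \<C> where \<C>: "\<C> \<subseteq> snd S" "M = \<Union>\<C>" using M by (auto simp: super_normal_def super_classes_def)
  show "\<forall>g\<in>M. super_cl S g \<subseteq> M"
  proof
    fix g assume "g \<in> M"
    then obtain C where "C \<in> \<C>" "g \<in> C" using \<C> by auto
    then show "super_cl S g \<subseteq> M" using super_cl_eq[of C g] \<C> by auto
  qed
next
  assume M: "subgroup M G \<and> (\<forall>g\<in>M. super_cl S g \<subseteq> M)"
  then have MG: "M \<subseteq> carrier G" by (simp add: subgroup.subset)
  then have "super_cl S ` M \<subseteq> snd S" using super_cl(1) by auto
  moreover have "M = \<Union> (super_cl S ` M)"
  proof
    show "M \<subseteq> \<Union> (super_cl S ` M)" using super_cl(2) MG by auto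
    show "\<Union> (super_cl S ` M) \<subseteq> M" using M by (simp add: UN_subset_iff)
  qed
  ultimately show "super_normal G S M"
    using M unfolding super_normal_def super_classes_def
    by (intro conjI exI[of _ "super_cl S ` M"]) simp_all
qed

lemma super_cl_conj:
  assumes "g \<in> carrier G" "h \<in> carrier G"
  shows "h \<otimes> g \<otimes> inv h \<in> super_cl S g"
  using superclass_function_conj[OF superclass_function_class[OF assms(1)] assms] super_cl[OF assms(1)]
  by (simp split: if_splits)

text \<open>Classes are invariant under conjugation, so a union of classes is as well. This is why left and right
  cosets can be interchanged in the comparison with \<open>\<Delta>\<close>-products.\<close>

lemma super_normal_imp_normal:
  assumes "super_normal G S M"
  shows "M \<lhd> G"
proof -
  have sub: "subgroup M G" and closed: "\<And>g. g \<in> M \<Longrightarrow> super_cl S g \<subseteq> M"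
    using assms by (auto simp: super_normal_iff)
  have "h \<otimes> g \<otimes> inv h \<in> M" if "h \<in> carrier G" "g \<in> M" for g h
    using super_cl_conj[of g h] closed[OF that(2)] subgroup.mem_carrier[OF sub that(2)] that(1) by blast
  then show ?thesis using sub by (simp add: normal_inv_iff)
qed

lemma super_cl_inv:
  assumes g: "g \<in> carrier G" and k: "k \<in> super_cl S (inv g)"
  shows "inv k \<in> super_cl S g"
proof -
  have "superclass_function (\<lambda>x. if inv x \<in> super_cl S g then 1 else 0)"
    using superclass_function_inverse[OF superclass_function_class[OF g]] .
  from superclass_functionD[OF this _ k] show ?thesis
    using g super_cl[OF g] by (simp split: if_splits)
qed

text \<open>The convolution of the indicators of two classes counts the factorizations of an element into
  factors from these classes. This count is constant on classes and positive at \<open>g \<otimes> h\<close>.\<close>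

lemma super_cl_mult:
  assumes g: "g \<in> carrier G" and h: "h \<in> carrier G" and k: "k \<in> super_cl S (g \<otimes> h)"
  obtains a b where "a \<in> super_cl S g" "b \<in> super_cl S h" "k = a \<otimes> b"
proof -
  let ?f = "\<lambda>x. if x \<in> super_cl S g then 1 else 0 :: complex"
    and ?h = "\<lambda>x. if x \<in> super_cl S h then 1 else 0 :: complex"
  have kG: "k \<in> carrier G" using super_cl_closed[OF _ k] g h by simp
  have count: "convolve ?f ?h x
    = of_nat (card {a \<in> carrier G. a \<in> super_cl S g \<and> inv a \<otimes> x \<in> super_cl S h})" for x
  proof -
    have "convolve ?f ?h x
      = (\<Sum>a\<in>carrier G. if a \<in> super_cl S g \<and> inv a \<otimes> x \<in> super_cl S h then 1 else 0)"
      unfolding convolve_def by (intro sum.cong) auto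
    then show ?thesis using finite_carrier by (simp add: sum.If_cases Int_def)
  qed
  have "convolve ?f ?h k = convolve ?f ?h (g \<otimes> h)"
    using g h k
    by (intro superclass_functionD superclass_function_convolve superclass_function_class) auto
  then have eq: "card {a \<in> carrier G. a \<in> super_cl S g \<and> inv a \<otimes> k \<in> super_cl S h}
      = card {a \<in> carrier G. a \<in> super_cl S g \<and> inv a \<otimes> (g \<otimes> h) \<in> super_cl S h}"
    unfolding count by simp
  have "g \<in> {a \<in> carrier G. a \<in> super_cl S g \<and> inv a \<otimes> (g \<otimes> h) \<in> super_cl S h}"
    using g h super_cl by (simp flip: m_assoc)
  then have "card {a \<in> carrier G. a \<in> super_cl S g \<and> inv a \<otimes> (g \<otimes> h) \<in> super_cl S h} \<noteq> 0"
    using finite_carrier by auto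
  then have "{a \<in> carrier G. a \<in> super_cl S g \<and> inv a \<otimes> k \<in> super_cl S h} \<noteq> {}"
    unfolding eq[symmetric] by (metis card.empty)
  then obtain a where "a \<in> carrier G" "a \<in> super_cl S g" "inv a \<otimes> k \<in> super_cl S h" by blast
  then show ?thesis using that[of a "inv a \<otimes> k"] kG by (simp flip: m_assoc)
qed

abbreviation commutator :: "'a set" where "commutator \<equiv> super_comm G (carrier G) S"

text \<open>By \<open>super_cl_inv\<close> and \<open>super_cl_mult\<close> the set of generators $g^{-1}k$ is closed under passing to
  other elements of the same class, and so is the subgroup generated by any such set.\<close>

lemma super_normal_commutator: "super_normal G S commutator"
proof -
  let ?D = "{inv g \<otimes> k |g k. g \<in> carrier G \<and> k \<in> super_cl S g}"
  have D: "?D \<subseteq> carrier G" using super_cl_closed by auto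
  have D_closed: "super_cl S x \<subseteq> ?D" if x: "x \<in> ?D" for x
  proof
    fix y assume y: "y \<in> super_cl S x"
    obtain g k where gk: "x = inv g \<otimes> k" "g \<in> carrier G" "k \<in> super_cl S g" using x by blast
    obtain a b where ab: "a \<in> super_cl S (inv g)" "b \<in> super_cl S k" "y = a \<otimes> b"
      using super_cl_mult[of "inv g" k y] y gk super_cl_closed by auto
    have a: "a \<in> carrier G" "inv a \<in> super_cl S g"
      using super_cl_closed[OF _ ab(1)] super_cl_inv[OF gk(2) ab(1)] gk(2) by auto
    have "super_cl S (inv a) = super_cl S k"
      using super_cl_same[OF gk(2)] a gk(3) by simp
    then have "y = inv (inv a) \<otimes> b \<and> inv a \<in> carrier G \<and> b \<in> super_cl S (inv a)"
      using ab a by simp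
    then show "y \<in> ?D" by blast
  qed
  have "super_cl S x \<subseteq> generate G ?D" if "x \<in> generate G ?D" for x
    using that
  proof (induction rule: generate.induct)
    case one
    then show ?case using super_cl_eq[OF one_class] generate.one by auto
  next
    case (incl h)
    show ?case by (rule subset_trans[OF D_closed[OF incl]]) (rule subsetI, rule generate.incl)
  next
    case (inv h)
    show ?case
    proof
      fix y assume y: "y \<in> super_cl S (inv h)"
      have h: "h \<in> carrier G" by (rule subsetD[OF D inv])
      have "inv y \<in> ?D" using super_cl_inv[OF h y] D_closed[OF inv] by (rule rev_subsetD)
      then have "inv (inv y) \<in> generate G ?D" by (rule generate.inv)
      moreover have "y \<in> carrier G" using super_cl_closed[OF _ y] h by simp
      ultimately show "y \<in> generate G ?D" by simp
    qed
  next
    case (eng h1 h2)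
    show ?case
    proof
      fix y assume y: "y \<in> super_cl S (h1 \<otimes> h2)"
      have "h1 \<in> carrier G" "h2 \<in> carrier G"
        using eng generate_in_carrier[OF D] by auto
      then obtain a b where "a \<in> super_cl S h1" "b \<in> super_cl S h2" "y = a \<otimes> b"
        using super_cl_mult[OF _ _ y] by metis
      moreover have "a \<in> generate G ?D" "b \<in> generate G ?D"
        using \<open>a \<in> super_cl S h1\<close> \<open>b \<in> super_cl S h2\<close> eng.IH by (auto elim: subsetD)
      ultimately show "y \<in> generate G ?D" by (simp only: generate.eng)
    qed
  qed
  then show ?thesis
    unfolding super_normal_iff super_comm_def using generate_is_subgroup[OF D] by (intro conjI ballI)
qed

section \<open>Classes, cosets of the commutator and vanishing\<close>

lemma commutator_subset: "commutator \<subseteq> carrier G"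
  using super_normal_commutator subgroup.subset unfolding super_normal_def by metis

lemma finite_commutator: "finite commutator"
  by (rule finite_subset[OF commutator_subset finite_carrier])

lemma super_cl_subset_coset:
  assumes "g \<in> carrier G"
  shows "super_cl S g \<subseteq> g <# commutator"
proof
  fix k assume k: "k \<in> super_cl S g"
  then have "inv g \<otimes> k \<in> commutator"
    unfolding super_comm_def using assms by (intro generate.incl) auto
  moreover have "k = g \<otimes> (inv g \<otimes> k)"
    using assms super_cl_closed[OF assms k] by (simp flip: m_assoc)
  ultimately show "k \<in> g <# commutator" by (auto simp: l_coset_def)
qed

lemma convolve_indicator_subgroup:
  assumes M: "subgroup M G" and g: "g \<in> carrier G"
  shows "convolve f (\<lambda>x. if x \<in> M then 1 else 0) g = (\<Sum>m\<in>M. f (g \<otimes> m))"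
proof -
  have MG: "M \<subseteq> carrier G" using subgroup.subset[OF M] .
  have "convolve f (\<lambda>x. if x \<in> M then 1 else 0) g = (\<Sum>a\<in>{a \<in> carrier G. inv a \<otimes> g \<in> M}. f a)"
    using finite_carrier
    by (simp add: convolve_def if_distrib[of "\<lambda>z. _ * z"] sum.inter_filter cong: if_cong)
  also have "\<dots> = (\<Sum>m\<in>M. f (g \<otimes> m))"
  proof (rule sum.reindex_bij_witness[of _ "\<lambda>m. g \<otimes> m" "\<lambda>a. inv g \<otimes> a"])
    fix a assume a: "a \<in> {a \<in> carrier G. inv a \<otimes> g \<in> M}"
    then have "inv (inv a \<otimes> g) \<in> M" using subgroup.m_inv_closed[OF M] by blast
    then show "inv g \<otimes> a \<in> M" using a g by (simp add: inv_mult_group)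
    show "g \<otimes> (inv g \<otimes> a) = a" "f (g \<otimes> (inv g \<otimes> a)) = f a"
      using a g by (simp_all flip: m_assoc)
  next
    fix m assume m: "m \<in> M"
    then have mG: "m \<in> carrier G" using MG by auto
    show "inv g \<otimes> (g \<otimes> m) = m" using mG g by (simp flip: m_assoc)
    have "inv (g \<otimes> m) \<otimes> g = inv m" using mG g by (simp add: inv_mult_group m_assoc)
    then show "g \<otimes> m \<in> {a \<in> carrier G. inv a \<otimes> g \<in> M}"
      using mG g subgroup.m_inv_closed[OF M m] by simp
  qed
  finally show ?thesis .
qed

text \<open>The indicator of \<open>M\<close> is a combination of the \<open>\<sigma> X'\<close>, so convolving \<open>\<sigma> X\<close> with it multiplies \<open>\<sigma> X\<close>
  by a scalar \<open>b\<close>. The coset sums do not change when \<open>g\<close> is multiplied by an element of \<open>M\<close>, so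
  for \<open>b \<noteq> 0\<close> the function \<open>\<sigma> X\<close> is itself constant on \<open>M\<close>, which puts \<open>M\<close> in its kernel. If \<open>M\<close>
  is in the kernel, then the value at \<open>\<one>\<close> gives \<open>b = card M\<close>.\<close>

lemma \<sigma>_coset_sum:
  assumes M: "super_normal G S M" and X: "X \<in> fst S" and g: "g \<in> carrier G"
  shows "(\<Sum>m\<in>M. \<sigma> X (g \<otimes> m))
    = (if M \<subseteq> char_ker G (\<sigma> X) then of_nat (card M) * \<sigma> X g else 0)"
proof -
  have sub: "subgroup M G" using M by (simp add: super_normal_def)
  have MG: "M \<subseteq> carrier G" using subgroup.subset[OF sub] .
  have ind: "superclass_function (\<lambda>x. if x \<in> M then 1 else 0)"
    using M MG by (intro superclass_function_indicator) (auto simp: super_normal_iff)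
  obtain c where c: "\<And>g. g \<in> carrier G \<Longrightarrow>
      (if g \<in> M then 1 else 0) = (\<Sum>X\<in>fst S. c X * \<sigma> X g)"
    using superclass_function_expansion[OF ind] by metis
  define b where "b = c X * of_nat (card (carrier G))"
  have eigen: "(\<Sum>m\<in>M. \<sigma> X (g \<otimes> m)) = b * \<sigma> X g" if "g \<in> carrier G" for g
    using \<sigma>_convolve_combination[OF c X that] convolve_indicator_subgroup[OF sub that, of "\<sigma> X"]
    by (simp add: b_def)
  have one: "(\<Sum>m\<in>M. \<sigma> X m) = b * \<sigma> X \<one>"
    using eigen[of \<one>] MG by (simp add: subset_iff cong: sum.cong)
  show ?thesis
  proof (cases "M \<subseteq> char_ker G (\<sigma> X)")
    case True
    then have "(\<Sum>m\<in>M. \<sigma> X m) = (\<Sum>m\<in>M. \<sigma> X \<one>)"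
      by (intro sum.cong) (auto simp: char_ker_def)
    then have "b = of_nat (card M)" using one \<sigma>_one_nonzero[OF X] by simp
    then show ?thesis using True eigen[OF g] by simp
  next
    case False
    have "b = 0"
    proof (rule ccontr)
      assume b: "b \<noteq> 0"
      have "\<sigma> X n = \<sigma> X \<one>" if n: "n \<in> M" for n
      proof -
        have nG: "n \<in> carrier G" using n MG by auto
        have "b * \<sigma> X n = (\<Sum>m\<in>M. \<sigma> X (n \<otimes> m))" using eigen[OF nG] by simp
        also have "\<dots> = (\<Sum>m\<in>M. \<sigma> X m)"
          by (rule sum.reindex_bij_witness[of _ "\<lambda>m. inv n \<otimes> m" "\<lambda>m. n \<otimes> m"])
            (use n nG MG subgroup.m_closed[OF sub] subgroup.m_inv_closed[OF sub] in
              \<open>auto simp: subset_iff simp flip: m_assoc\<close>)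
        finally show ?thesis using one b by simp
      qed
      then show False using False MG by (auto simp: char_ker_def)
    qed
    then show ?thesis using False eigen[OF g] by simp
  qed
qed

text \<open>Expand the indicator of the class of \<open>g\<close> in the \<open>\<sigma> X\<close> and sum over the coset of \<open>g\<close>. By
  \<open>\<sigma>_coset_sum\<close> and the vanishing at \<open>g\<close>, this multiplies the value at \<open>g\<close> of every term, and so that of
  the indicator, by \<open>card commutator\<close>.\<close>

lemma vanishing_imp_card_class:
  assumes g: "g \<in> carrier G"
    and van: "\<And>\<chi>. \<chi> \<in> super_Irr_over G S (commutator) \<Longrightarrow> \<chi> g = 0"
  shows "card (super_cl S g) = card (commutator)"
proof -
  let ?f = "\<lambda>x. if x \<in> super_cl S g then 1 else 0 :: complex"
  note MG = commutator_subset and finM = finite_commutator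
  obtain c where c: "\<And>g. g \<in> carrier G \<Longrightarrow> ?f g = (\<Sum>X\<in>fst S. c X * \<sigma> X g)"
    using superclass_function_expansion[OF superclass_function_class[OF g]] by metis
  have coset: "card {m \<in> commutator. g \<otimes> m \<in> super_cl S g} = card (super_cl S g)"
  proof (rule bij_betw_same_card[of "\<lambda>m. g \<otimes> m"])
    show "bij_betw (\<lambda>m. g \<otimes> m) {m \<in> commutator. g \<otimes> m \<in> super_cl S g} (super_cl S g)"
      unfolding bij_betw_def
    proof
      show "inj_on (\<lambda>m. g \<otimes> m) {m \<in> commutator. g \<otimes> m \<in> super_cl S g}"
        using MG by (intro inj_on_subset[OF inj_on_cmult[OF g]]) auto
      show "(\<lambda>m. g \<otimes> m) ` {m \<in> commutator. g \<otimes> m \<in> super_cl S g} = super_cl S g"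
        using super_cl_subset_coset[OF g] by (auto simp: l_coset_def)
    qed
  qed
  have "of_nat (card (super_cl S g)) = (\<Sum>m\<in>commutator. ?f (g \<otimes> m))"
    unfolding coset[symmetric] using finM by (simp add: sum.If_cases Int_def)
  also have "\<dots> = (\<Sum>m\<in>commutator. \<Sum>X\<in>fst S. c X * \<sigma> X (g \<otimes> m))"
    using MG g by (intro sum.cong refl c) auto
  also have "\<dots> = (\<Sum>X\<in>fst S. c X * (\<Sum>m\<in>commutator. \<sigma> X (g \<otimes> m)))"
    by (subst sum.swap) (simp add: sum_distrib_left)
  also have "\<dots> = (\<Sum>X\<in>fst S. c X * (of_nat (card commutator) * \<sigma> X g))"
  proof (intro sum.cong refl)
    fix X assume X: "X \<in> fst S"
    have "\<sigma> X g = 0" if "\<not> commutator \<subseteq> char_ker G (\<sigma> X)"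
      using van that X by (simp add: super_Irr_over_def super_Irr_def)
    then show "c X * (\<Sum>m\<in>commutator. \<sigma> X (g \<otimes> m)) = c X * (of_nat (card commutator) * \<sigma> X g)"
      by (simp add: \<sigma>_coset_sum[OF super_normal_commutator X g])
  qed
  also have "\<dots> = of_nat (card commutator) * (\<Sum>X\<in>fst S. c X * \<sigma> X g)"
    by (simp add: sum_distrib_left mult_ac)
  also have "\<dots> = of_nat (card commutator)" using c[OF g] super_cl[OF g] by simp
  finally show ?thesis by simp
qed

text \<open>\<open>\<sigma> X\<close> is constant on the coset, so its sum over the coset is \<open>card M * \<sigma> X g\<close>; by \<open>\<sigma>_coset_sum\<close>
  this sum is zero.\<close>

lemma full_coset_imp_vanishing:
  assumes g: "g \<in> carrier G"
    and M: "super_normal G S M"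
    and coset: "\<And>m. m \<in> M \<Longrightarrow> g \<otimes> m \<in> super_cl S g"
    and \<chi>: "\<chi> \<in> super_Irr_over G S M"
  shows "\<chi> g = 0"
proof -
  obtain X where X: "X \<in> fst S" "\<chi> = \<sigma> X" "\<not> M \<subseteq> char_ker G (\<sigma> X)"
    using \<chi> by (auto simp: super_Irr_over_def super_Irr_def)
  have sub: "subgroup M G" using M by (simp add: super_normal_def)
  have "finite M" "M \<noteq> {}"
    using subgroup.subset[OF sub] subgroup.one_closed[OF sub] finite_subset[OF _ finite_carrier] by auto
  then have card: "card M \<noteq> 0" by simp
  have "(\<Sum>m\<in>M. \<sigma> X (g \<otimes> m)) = (\<Sum>m\<in>M. \<sigma> X g)"
    by (intro sum.cong refl \<sigma>_constant[OF X(1) super_cl(1)[OF g] coset super_cl(2)[OF g]])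
  then have "of_nat (card M) * \<sigma> X g = 0"
    using \<sigma>_coset_sum[OF M X(1) g] X(3) by simp
  then show ?thesis using card X(2) by simp
qed

lemma card_class_iff_coset:
  assumes g: "g \<in> carrier G"
  shows "card (super_cl S g) = card (commutator)
    \<longleftrightarrow> super_cl S g = g <# commutator"
proof -
  note MG = commutator_subset and finM = finite_commutator
  have "inj_on (\<lambda>m. g \<otimes> m) commutator" by (rule inj_on_subset[OF inj_on_cmult[OF g] MG])
  then have "card (g <# commutator) = card commutator"
    by (simp add: l_coset_def UNION_singleton_eq_range card_image)
  moreover have "finite (g <# commutator)" using finM by (simp add: l_coset_def)
  ultimately show ?thesis using super_cl_subset_coset[OF g] card_subset_eq by metis
qed

lemma translates_iff_coset:
  assumes g: "g \<in> carrier G"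
  shows "(\<forall>z\<in>commutator. \<exists>y\<in>super_cl S g. inv g \<otimes> y = z)
    \<longleftrightarrow> super_cl S g = g <# commutator"
proof -
  note MG = commutator_subset
  have "(\<exists>y\<in>super_cl S g. inv g \<otimes> y = z) \<longleftrightarrow> g \<otimes> z \<in> super_cl S g" if "z \<in> commutator" for z
  proof
    assume "\<exists>y\<in>super_cl S g. inv g \<otimes> y = z"
    then obtain y where y: "y \<in> super_cl S g" "inv g \<otimes> y = z" by blast
    then have "g \<otimes> z = y" using g super_cl_closed[OF g] by (auto simp flip: m_assoc)
    then show "g \<otimes> z \<in> super_cl S g" using y by simp
  next
    assume "g \<otimes> z \<in> super_cl S g"
    moreover have "inv g \<otimes> (g \<otimes> z) = z" using g that MG by (auto simp flip: m_assoc)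
    ultimately show "\<exists>y\<in>super_cl S g. inv g \<otimes> y = z" by blast
  qed
  then have "(\<forall>z\<in>commutator. \<exists>y\<in>super_cl S g. inv g \<otimes> y = z) \<longleftrightarrow> g <# commutator \<subseteq> super_cl S g"
    by (auto simp: l_coset_def)
  then show ?thesis using super_cl_subset_coset[OF g] by blast
qed

text \<open>A class contained in a single coset can only be a union of cosets by being that coset.\<close>

lemma union_of_cosets_iff_coset:
  assumes g: "g \<in> carrier G"
  shows "(\<exists>\<C>\<subseteq>rcosets (commutator). super_cl S g = \<Union>\<C>)
    \<longleftrightarrow> super_cl S g = g <# commutator"
proof -
  have normal: "commutator \<lhd> G" by (rule super_normal_imp_normal[OF super_normal_commutator])
  then have sub: "subgroup commutator G" by (simp add: normal_def)
  have lr: "g <# commutator = commutator #> g" if "g \<in> carrier G" for g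
    using normal.coset_eq[OF normal] that by simp
  show ?thesis
  proof
    assume "\<exists>\<C>\<subseteq>rcosets commutator. super_cl S g = \<Union>\<C>"
    then obtain \<C> where \<C>: "\<C> \<subseteq> rcosets commutator" "super_cl S g = \<Union>\<C>" by blast
    obtain R where R: "R \<in> \<C>" "g \<in> R" using super_cl(2)[OF g] \<C> by auto
    then obtain x where x: "x \<in> carrier G" "R = commutator #> x" using \<C> by (auto simp: RCOSETS_def)
    have "R = commutator #> g" using repr_independence[OF _ x(1) sub, of g] R x by simp
    then show "super_cl S g = g <# commutator"
      using R \<C> lr[OF g] super_cl_subset_coset[OF g] by blast
  next
    assume "super_cl S g = g <# commutator"
    then have "{commutator #> g} \<subseteq> rcosets commutator \<and> super_cl S g = \<Union>{commutator #> g}"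
      using g lr[OF g] by (auto simp: RCOSETS_def)
    then show "\<exists>\<C>\<subseteq>rcosets commutator. super_cl S g = \<Union>\<C>" by blast
  qed
qed

lemma vanishing_iff_coset:
  assumes g: "g \<in> carrier G"
  shows "(\<forall>\<chi>\<in>super_Irr_over G S (commutator). \<chi> g = 0)
    \<longleftrightarrow> super_cl S g = g <# commutator"
proof
  assume "\<forall>\<chi>\<in>super_Irr_over G S (commutator). \<chi> g = 0"
  then show "super_cl S g = g <# commutator"
    using vanishing_imp_card_class[OF g] card_class_iff_coset[OF g] by blast
next
  assume "super_cl S g = g <# commutator"
  then show "\<forall>\<chi>\<in>super_Irr_over G S (commutator). \<chi> g = 0"
    using full_coset_imp_vanishing[OF g super_normal_commutator] by (auto simp: l_coset_def)
qed

lemma class_disjoint_iff: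
  assumes N: "super_normal G S N" and g: "g \<in> carrier G"
  shows "super_cl S g \<inter> N = {} \<longleftrightarrow> g \<notin> N"
proof
  show "g \<notin> N" if "super_cl S g \<inter> N = {}" using that super_cl(2)[OF g] by blast
  show "super_cl S g \<inter> N = {}" if "g \<notin> N"
  proof (rule ccontr)
    assume "super_cl S g \<inter> N \<noteq> {}"
    then obtain h where h: "h \<in> super_cl S g" "h \<in> N" by blast
    then have "super_cl S g \<subseteq> N"
      using N super_cl_same[OF g h(1)] by (auto simp: super_normal_iff)
    then show False using that super_cl(2)[OF g] by blast
  qed
qed

end

theorem theorem1p1:
  fixes G :: "('a, 'b) monoid_scheme" and S :: "'a super_theory" and N :: "'a set"
  assumes "group G" and "finite (carrier G)"
    and "supercharacter_theory G S"
    and "super_normal G S N"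
  defines "GS \<equiv> super_comm G (carrier G) S"
  defines "c1 \<equiv> super_GCP G S N"
    and "c2 \<equiv> super_Delta_product G S GS N"
    and "c3 \<equiv> \<forall>g\<in>carrier G - N. card (super_cl S g) = card GS"
    and "c4 \<equiv> \<forall>g\<in>carrier G - N. \<forall>z\<in>GS. \<exists>y\<in>super_cl S g. inv\<^bsub>G\<^esub> g \<otimes>\<^bsub>G\<^esub> y = z"
    and "c5 \<equiv> \<forall>\<chi>\<in>super_Irr_over G S GS. \<forall>g\<in>carrier G - N. \<chi> g = 0"
  shows "(c1 \<longleftrightarrow> c3) \<and> (c1 \<longleftrightarrow> c4) \<and> (c1 \<longleftrightarrow> c5) \<and> (GS \<subseteq> N \<longrightarrow> (c1 \<longleftrightarrow> c2))"
proof -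
  interpret supercharacters G S
    using assms(1-3)
    by (simp add: supercharacters_def supercharacters_axioms_def finite_group_def finite_group_axioms_def)
  define coset where "coset \<longleftrightarrow> (\<forall>g\<in>carrier G - N. super_cl S g = g <#\<^bsub>G\<^esub> GS)"
  have N: "super_normal G S N" by fact
  have 1: "c1 \<longleftrightarrow> coset"
    using N vanishing_iff_coset
    by (auto simp: c1_def super_GCP_def super_Camina_element_def coset_def GS_def)
  have 3: "c3 \<longleftrightarrow> coset" using card_class_iff_coset by (auto simp: c3_def coset_def GS_def)
  have 4: "c4 \<longleftrightarrow> coset" using translates_iff_coset by (auto simp: c4_def coset_def GS_def)
  have 5: "c5 \<longleftrightarrow> coset"
  proof -
    have "c5 \<longleftrightarrow> (\<forall>g\<in>carrier G - N. \<forall>\<chi>\<in>super_Irr_over G S GS. \<chi> g = 0)"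
      unfolding c5_def by blast
    then show ?thesis using vanishing_iff_coset by (auto simp: coset_def GS_def)
  qed
  have 2: "c2 \<longleftrightarrow> coset" if "GS \<subseteq> N"
  proof -
    let ?P = "\<lambda>C. \<exists>\<C>\<subseteq>rcosets\<^bsub>G\<^esub> GS. C = \<Union>\<C>"
    have "c2 \<longleftrightarrow> (\<forall>C\<in>snd S. C \<inter> N = {} \<longrightarrow> ?P C)"
      using that N super_normal_commutator
      by (simp add: c2_def super_Delta_product_def super_classes_def GS_def)
    also have "\<dots> \<longleftrightarrow> (\<forall>g\<in>carrier G - N. ?P (super_cl S g))"
    proof
      assume L: "\<forall>C\<in>snd S. C \<inter> N = {} \<longrightarrow> ?P C"
      show "\<forall>g\<in>carrier G - N. ?P (super_cl S g)"
      proof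
        fix g assume "g \<in> carrier G - N"
        then show "?P (super_cl S g)" using L super_cl(1)[of g] class_disjoint_iff[OF N, of g] by blast
      qed
    next
      assume R: "\<forall>g\<in>carrier G - N. ?P (super_cl S g)"
      show "\<forall>C\<in>snd S. C \<inter> N = {} \<longrightarrow> ?P C"
      proof (intro ballI impI)
        fix C assume C: "C \<in> snd S" "C \<inter> N = {}"
        have "C \<noteq> {}" using C(1) partition_classes by (auto simp: partition_on_def)
        then obtain g where "g \<in> C" by blast
        then have "g \<in> carrier G - N" "super_cl S g = C"
          using C class_subset super_cl_eq by auto
        then show "?P C" using R by metis
      qed
    qed
    also have "\<dots> \<longleftrightarrow> coset"
      unfolding coset_def GS_def using union_of_cosets_iff_coset by (intro ball_cong refl) auto
    finally show ?thesis .
  qed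
  show ?thesis using 1 2 3 4 5 by blast
qed

end
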